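(* Let $1\le m<n<N$, let $A,B\in\mathbb{C}^{N\times N}$ be Hermitian with $B\prec 0$, let $\lambda_1\le\cdots\le\lambda_N$ be the eigenvalues of $A+B$, and assume $\lambda_{n+1}-\lambda_n>0$ and $\lambda_{m+1}-\lambda_m>0$. Let $P$ (resp. $P_m$) be the orthogonal projector onto the span of the eigenvectors of $A+B$ for its lowest $n$ (resp. $m$) eigenvalues. Let $P^{(0)}\in\mathcal{D}$, let $P^{(k+1)}=\mathfrak{F}(P^{(k)})$, and suppose that $P^{(k)}\to P$ as $k\to\infty$. Then $P_m^{(k)}\to P_m$, and with $\Delta_m=\lambda_{n+1}-\lambda_m$ there exist a number $$\gamma_m\le\frac{\|B\|_2}{\|B\|_2+\Delta_m}$$ and a constant $C>0$, independent of $k$, such that $$\|P_m-P_m^{(k)}\|_2\le C\,\gamma_m^k\,\|P-P^{(0)}\|_2\qquad\text{for all }k\ge1.$$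
   Context: $\|\cdot\|_2$ is the spectral norm. $\mathcal{D}$ is the set of rank-$n$ orthogonal projectors in $\mathbb{C}^{N\times N}$. For a Hermitian matrix $H$, $\lambda_i\{H\}$ is its $i$-th smallest eigenvalue (with multiplicity). For $Q\in\mathcal{D}$ the adaptive compression of $B\prec0$ is $\underline{B}[Q]=B(QBQ)^\dagger B$ ($\dagger$ is the Moore–Penrose pseudoinverse); equivalently $\underline{B}[Q]=BV(V^*BV)^{-1}V^*B$ for any $N\times n$ matrix $V$ with orthonormal columns and $Q=VV^*$. Fixed point map $\mathfrak{F}:\mathcal{D}\to\mathcal{D}$: $\mathfrak{F}(Q)=\sum_{i=1}^n u_iu_i^*$ where $u_1,\dots,u_n$ are orthonormal with $(A+\underline{B}[Q])u_i=\lambda_i\{A+\underline{B}[Q]\}u_i$. If $A+\underline{B}[Q]$ has a positive gap between its $n$-th and $(n+1)$-th eigenvalues this is the unique orthogonal projector onto the span of the lowest $n$ eigenvectors; otherwise an arbitrary (fixed) choice is made within the eigenspace of the $n$-th eigenvalue. For $k\ge1$, $P_m^{(k)}$ is the rank-$m$ orthogonal projector onto the span of eigenvectors for the lowest $m$ eigenvalues of $A+\underline{B}[P^{(k-1)}]$ (an arbitrary choice being made within the eigenspace of the $m$-th eigenvalue if the $m$-th and $(m+1)$-th eigenvalues coincide). *)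

theory Defs
  imports "HOL-Analysis.Analysis" "HOL-Computational_Algebra.Computational_Algebra"
begin

definition conj_transpose :: "complex^'n^'m \<Rightarrow> complex^'m^'n" where
  "conj_transpose A = (\<chi> i j. cnj (A $ j $ i))"

definition hermitian :: "complex^'n^'n \<Rightarrow> bool" where
  "hermitian A \<longleftrightarrow> conj_transpose A = A"

text \<open>The complex inner product \<open>x\<^sup>* y\<close>; the library's \<open>\<bullet>\<close> on
  \<open>complex^'n\<close> is only its real part.\<close>

definition cdot :: "complex^'n \<Rightarrow> complex^'n \<Rightarrow> complex" where
  "cdot x y = (\<Sum>i\<in>UNIV. cnj (x $ i) * y $ i)"

text \<open>The matrix \<open>u u\<^sup>*\<close>.\<close>

definition outer :: "complex^'n \<Rightarrow> complex^'n^'n" where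
  "outer u = (\<chi> i j. u $ i * cnj (u $ j))"

text \<open>For Hermitian \<open>B\<close> the number \<open>x\<^sup>* B x\<close> is real, so taking \<open>Re\<close> loses nothing.\<close>

definition negative_definite :: "complex^'n^'n \<Rightarrow> bool" where
  "negative_definite B \<longleftrightarrow> hermitian B \<and> (\<forall>x. x \<noteq> 0 \<longrightarrow> Re (cdot x (B *v x)) < 0)"

text \<open>Operator norm induced by the norm of \<open>complex^'n\<close>, which is the Euclidean one.\<close>

definition spectral_norm :: "complex^'n^'n \<Rightarrow> real" where
  "spectral_norm A = onorm (\<lambda>x. A *v x)"

definition charpoly :: "complex^'n^'n \<Rightarrow> complex poly" where
  "charpoly A = det (\<chi> i j. (if i = j then [:0, 1:] else 0) - [:A $ i $ j:])"

text \<open>The \<open>i\<close>-th smallest eigenvalue, counted from \<open>i = 1\<close> and with multiplicity.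
  Meaningful for Hermitian \<open>H\<close> (all roots of the characteristic polynomial are real)
  and \<open>1 \<le> i \<le> CARD('n)\<close>.\<close>

definition nth_eigenvalue :: "nat \<Rightarrow> complex^'n^'n \<Rightarrow> real" where
  "nth_eigenvalue i H =
     sorted_list_of_multiset (image_mset Re (proots (charpoly H))) ! (i - 1)"

definition orthogonal_projector :: "complex^'n^'n \<Rightarrow> bool" where
  "orthogonal_projector Q \<longleftrightarrow> hermitian Q \<and> Q ** Q = Q"

definition orthogonal_projector_onto :: "(complex^'n) set \<Rightarrow> complex^'n^'n \<Rightarrow> bool" where
  "orthogonal_projector_onto S Q \<longleftrightarrow> orthogonal_projector Q \<and> range (\<lambda>x. Q *v x) = S"

definition rank_projectors :: "nat \<Rightarrow> (complex^'n^'n) set" where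
  "rank_projectors r = {Q. orthogonal_projector Q \<and> rank Q = r}"

text \<open>The Moore--Penrose pseudoinverse, as the unique solution of the four Penrose equations.\<close>

definition pseudoinverse :: "complex^'n^'n \<Rightarrow> complex^'n^'n" where
  "pseudoinverse A = (THE X. A ** X ** A = A \<and> X ** A ** X = X \<and>
                             hermitian (A ** X) \<and> hermitian (X ** A))"

definition adaptive_compression :: "complex^'n^'n \<Rightarrow> complex^'n^'n \<Rightarrow> complex^'n^'n" where
  "adaptive_compression B Q = B ** pseudoinverse (Q ** B ** Q) ** B"

text \<open>\<open>u 1, \<dots>, u r\<close> are orthonormal eigenvectors of \<open>H\<close> for its lowest \<open>r\<close> eigenvalues.\<close>

definition lowest_eigenvectors :: "nat \<Rightarrow> complex^'n^'n \<Rightarrow> (nat \<Rightarrow> complex^'n) \<Rightarrow> bool" where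
  "lowest_eigenvectors r H u \<longleftrightarrow>
     (\<forall>i\<in>{1..r}. \<forall>j\<in>{1..r}. cdot (u i) (u j) = (if i = j then 1 else 0)) \<and>
     (\<forall>i\<in>{1..r}. H *v u i = complex_of_real (nth_eigenvalue i H) *s u i)"

text \<open>\<open>Q\<close> is the orthogonal projector onto the span of eigenvectors for the lowest \<open>r\<close>
  eigenvalues of \<open>H\<close>. It is unique if the \<open>r\<close>-th and the following eigenvalue differ;
  otherwise every choice within the eigenspace of the \<open>r\<close>-th eigenvalue is admitted.\<close>

definition lowest_spectral_projector :: "nat \<Rightarrow> complex^'n^'n \<Rightarrow> complex^'n^'n \<Rightarrow> bool" where
  "lowest_spectral_projector r H Q \<longleftrightarrow>
     (\<exists>u. lowest_eigenvectors r H u \<and> orthogonal_projector_onto (vec.span (u ` {1..r})) Q)"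

text \<open>\<open>F\<close> is a fixed point map for \<open>A, B\<close> and rank \<open>n\<close>: one fixed selection, for each
  rank-\<open>n\<close> projector \<open>Q\<close>, of an admissible value. Values outside the rank-\<open>n\<close> projectors
  are irrelevant.\<close>

definition fixed_point_map ::
  "nat \<Rightarrow> complex^'n^'n \<Rightarrow> complex^'n^'n \<Rightarrow> (complex^'n^'n \<Rightarrow> complex^'n^'n) \<Rightarrow> bool" where
  "fixed_point_map n A B F \<longleftrightarrow>
     (\<forall>Q\<in>rank_projectors n. \<exists>u.
        lowest_eigenvectors n (A + adaptive_compression B Q) u \<and>
        F Q = (\<Sum>i=1..n. outer (u i)))"

end

theory Submission
  imports Defs
begin

text \<open>
  Put \<open>H = A + B\<close> and, for a projector \<open>Q\<close>, let \<open>E = adaptive_compression B Q - B\<close>. Then \<open>E\<close> is a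
  Schur complement of \<open>- B\<close>: it is Hermitian, \<open>0 \<le> E \<le> - B\<close>, and \<open>E ** Q = 0\<close>
  (\<open>compression_error\<close>). The iteration diagonalises \<open>H + E k\<close>, where \<open>E k\<close> belongs to \<open>Pk k\<close>, so
  the errors \<open>E k\<close> are large operators that vanish on nearly the right subspace. All norms below are
  Frobenius norms, the inner product is \<open>X \<bullet> Y = Re (tr (X\<^sup>* Y))\<close>, and \<open>b\<close> is the spectral norm of
  \<open>B\<close>.

  Let \<open>p\<close> be \<open>P\<^sub>m\<close> and \<open>d = norm (P - Pk k)\<close>. Let \<open>F\<close> be the oblique projector onto the range of
  \<open>Pmk (k + 1)\<close> along the kernel of \<open>p\<close>, and \<open>Y = F - p\<close>. With \<open>\<G> Y = H ** Y - Y ** H\<close> and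
  \<open>K = p ** E ** F\<close>, invariance of the range under \<open>H + E\<close> is the Riccati equation
  \<open>E ** F = F ** K - \<G> Y\<close> (\<open>riccati\<close>), and \<open>K\<close> has size \<open>O(d)\<close>. The error is measured by the excess
  energy \<open>e = Re (tr K)\<close>, which is the sum of the lowest \<open>m\<close> eigenvalues of \<open>H + E\<close> minus that of
  \<open>H\<close>. Up to relative errors \<open>O(d)\<close> the Riccati equation yields

  \<^item> \<open>e = Y \<bullet> \<G> Y + F \<bullet> (E ** F)\<close> (\<open>energy_identity\<close>), and

  \<^item> \<open>e' = Y \<bullet> \<G> Y'\<close> for the next step (\<open>energy_step_identity\<close>): there \<open>E' ** F = 0\<close>, since the range
    of \<open>F\<close> lies in the range of the projector from which \<open>E'\<close> is built.

  From \<open>0 \<le> E \<le> b\<close> one has \<open>(norm (E ** F))\<^sup>2 \<le> b * (F \<bullet> (E ** F))\<close>, while \<open>E ** F\<close> is nearly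
  \<open>- \<G> Y\<close>. On the part of \<open>Y\<close> that maps out of the range of \<open>P\<close> the operator \<open>\<G>\<close> is at least
  \<open>\<Delta>\<^sub>m\<close>, and the part of \<open>Y\<close> inside the range of \<open>P\<close> is negligible because \<open>E\<close> is small there. Hence
  \<open>e \<ge> (1 + \<Delta>\<^sub>m / b) * (Y \<bullet> \<G> Y)\<close>, that is \<open>Y \<bullet> \<G> Y \<le> \<gamma> * e\<close> with \<open>\<gamma> = b / (b + \<Delta>\<^sub>m)\<close>
  (\<open>energy_estimate\<close>). The Cauchy-Schwarz inequality for \<open>\<G>\<close> turns the second identity into
  \<open>e' \<le> \<gamma> * sqrt e * sqrt e'\<close>, so \<open>sqrt e\<close> contracts by \<open>\<gamma>\<close> up to a factor \<open>1 + O(d + d')\<close>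
  (\<open>energy_contraction\<close>), and \<open>norm Y\<close> is bounded by a multiple of \<open>sqrt e\<close>.

  The factors \<open>1 + O(d + d')\<close> do no harm once the distances \<open>d\<close> are summable. The same estimate with
  \<open>p = P\<close>, that is with \<open>m\<close> replaced by \<open>n\<close>, shows this: \<open>Pk k\<close> tends to \<open>P\<close>, so eventually the
  contraction factor is bounded away from \<open>1\<close> and \<open>d\<close> decays geometrically
  (\<open>summable_of_contraction\<close>). Therefore \<open>sqrt e\<close> is bounded by a multiple of \<open>\<gamma> ^ k\<close>
  (\<open>perturbed_geometric_decay\<close>).

  Two global facts complete the argument. A quantitative Ky Fan inequality (\<open>ky_fan\<close>) bounds
  \<open>norm (Pmk (k + 1) - P\<^sub>m)\<close> by a multiple of \<open>d\<close> for every \<open>k\<close>, which gives convergence and starts the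
  local analysis. The constant \<open>C\<close> is chosen after the sequence, so if \<open>Pk 0 \<noteq> P\<close> the first finitely
  many steps and the factor \<open>spectral_norm (P - Pk 0)\<close> are absorbed into \<open>C\<close>; if \<open>Pk 0 = P\<close> the Ky Fan
  bound shows that the whole iteration is stationary.
\<close>

unbundle no fps_syntax

section \<open>Complex matrices as a Euclidean space\<close>

lemma conj_transpose_conj_transpose [simp]: "conj_transpose (conj_transpose A) = A"
  by (simp add: conj_transpose_def vec_eq_iff)

lemma conj_transpose_mult: "conj_transpose (A ** B) = conj_transpose B ** conj_transpose A"
  by (simp add: conj_transpose_def vec_eq_iff matrix_matrix_mult_def mult.commute)

lemma conj_transpose_add: "conj_transpose (A + B) = conj_transpose A + conj_transpose B"
  by (simp add: conj_transpose_def vec_eq_iff)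

lemma conj_transpose_diff: "conj_transpose (A - B) = conj_transpose A - conj_transpose B"
  by (simp add: conj_transpose_def vec_eq_iff)

lemma conj_transpose_mat1 [simp]: "conj_transpose (mat 1) = mat 1"
  by (auto simp add: conj_transpose_def vec_eq_iff mat_def)

lemma inner_matrix_sum:
  fixes X Y :: "complex^'n^'m"
  shows "X \<bullet> Y = (\<Sum>i\<in>UNIV. \<Sum>j\<in>UNIV. Re (cnj (X $ i $ j) * Y $ i $ j))"
  by (simp add: inner_vec_def inner_complex_def)

lemma inner_conj_transpose: "conj_transpose X \<bullet> conj_transpose Y = X \<bullet> Y"
  unfolding inner_matrix_sum by (subst sum.swap) (simp add: conj_transpose_def mult.commute)

lemma norm_conj_transpose [simp]: "norm (conj_transpose X) = norm X"
  by (simp add: norm_eq_sqrt_inner inner_conj_transpose)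

lemma inner_cdot: "x \<bullet> y = Re (cdot x y)"
  by (simp add: inner_vec_def inner_complex_def cdot_def)

lemma inner_vec_adjoint: "(A *v x) \<bullet> y = x \<bullet> (conj_transpose A *v y)"
proof -
  have "cdot (A *v x) y = cdot x (conj_transpose A *v y)"
    unfolding cdot_def matrix_vector_mult_def conj_transpose_def
    by (simp add: sum_distrib_left sum_distrib_right mult_ac)  (rule sum.swap)
  then show ?thesis by (simp add: inner_cdot)
qed

lemma inner_by_columns:
  fixes X Y :: "complex^'n^'m"
  shows "X \<bullet> Y = (\<Sum>j\<in>UNIV. column j X \<bullet> column j Y)"
  unfolding inner_matrix_sum by (subst sum.swap) (simp add: inner_vec_def column_def inner_complex_def)

lemma column_mult: "column j (A ** X) = A *v column j X"
  by (simp add: column_def matrix_matrix_mult_def matrix_vector_mult_def)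

lemma inner_adjoint_left: "(A ** X) \<bullet> Y = X \<bullet> (conj_transpose A ** Y)"
  by (simp add: inner_by_columns column_mult inner_vec_adjoint)

lemma inner_adjoint_right: "(X ** A) \<bullet> Y = X \<bullet> (Y ** conj_transpose A)"
  using inner_adjoint_left[of "conj_transpose A" "conj_transpose X" "conj_transpose Y"]
  by (metis conj_transpose_conj_transpose conj_transpose_mult inner_conj_transpose)

lemma norm_by_columns:
  fixes X :: "complex^'n^'m"
  shows "(norm X)^2 = (\<Sum>j\<in>UNIV. (norm (column j X))^2)"
  by (simp add: power2_norm_eq_inner inner_by_columns)

lemma norm_matrix_vector:
  fixes A :: "complex^'n^'m"
  shows "norm (A *v x) \<le> norm A * norm x"
proof -
  have row: "norm (\<Sum>j\<in>UNIV. A $ i $ j * x $ j) \<le> norm (A $ i) * norm x" for i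
  proof -
    have "norm (\<Sum>j\<in>UNIV. A $ i $ j * x $ j) \<le> (\<Sum>j\<in>UNIV. \<bar>norm (A $ i $ j)\<bar> * \<bar>norm (x $ j)\<bar>)"
      by (rule order_trans[OF norm_sum]) (simp add: norm_mult)
    also have "\<dots> \<le> norm (A $ i) * norm x"
      unfolding norm_vec_def by (rule L2_set_mult_ineq)
    finally show ?thesis .
  qed
  have "norm (A *v x) \<le> L2_set (\<lambda>i. norm (A $ i) * norm x) UNIV"
    unfolding norm_vec_def[of "A *v x"]
    by (rule L2_set_mono) (simp_all add: matrix_vector_mult_def row)
  also have "\<dots> = norm A * norm x"
    by (simp add: norm_vec_def[of A] L2_set_left_distrib)
  finally show ?thesis .
qed

lemma norm_mult_by_columns:
  fixes A :: "complex^'n^'m" and X :: "complex^'k^'n"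
  assumes "\<And>x. norm (A *v x) \<le> K * norm x" and "0 \<le> K"
  shows "norm (A ** X) \<le> K * norm X"
proof (rule power2_le_imp_le)
  have "(norm (A ** X))^2 = (\<Sum>j\<in>UNIV. (norm (A *v column j X))^2)"
    by (simp add: norm_by_columns column_mult)
  also have "\<dots> \<le> (\<Sum>j\<in>UNIV. (K * norm (column j X))^2)"
    by (intro sum_mono power_mono assms) simp
  also have "\<dots> = (K * norm X)^2"
    by (simp add: norm_by_columns power_mult_distrib sum_distrib_left)
  finally show "(norm (A ** X))^2 \<le> (K * norm X)^2" .
qed (use assms in simp)

lemma norm_matrix_mult:
  fixes A :: "complex^'n^'m" and X :: "complex^'k^'n"
  shows "norm (A ** X) \<le> norm A * norm X"
  by (rule norm_mult_by_columns) (simp_all add: norm_matrix_vector)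

lemma spectral_norm_le: "spectral_norm A \<le> norm A"
  unfolding spectral_norm_def by (rule onorm_le) (rule norm_matrix_vector)

lemma spectral_norm_bound: "norm (A *v x) \<le> spectral_norm A * norm x"
  unfolding spectral_norm_def by (rule onorm) (rule matrix_vector_mul_bounded_linear)

lemma matrix_diff_ldistrib:
  fixes A :: "'a::comm_ring_1^'n^'m"
  shows "A ** (B - C) = A ** B - A ** C"
  by (simp add: matrix_matrix_mult_def vec_eq_iff algebra_simps sum_subtractf)

lemma matrix_diff_rdistrib:
  fixes A :: "'a::comm_ring_1^'n^'m"
  shows "(A - B) ** C = A ** C - B ** C"
  by (simp add: matrix_matrix_mult_def vec_eq_iff algebra_simps sum_subtractf)

lemma matrix_plus_rdistrib:
  fixes A :: "'a::comm_ring_1^'n^'m"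
  shows "(A + B) ** C = A ** C + B ** C"
  by (simp add: matrix_matrix_mult_def vec_eq_iff algebra_simps sum.distrib)

lemma matrix_zero_left [simp]: "(0::'a::comm_ring_1^'n^'m) ** C = 0"
  by (simp add: matrix_matrix_mult_def vec_eq_iff)

lemma matrix_zero_right [simp]: "C ** (0::'a::comm_ring_1^'n^'m) = 0"
  by (simp add: matrix_matrix_mult_def vec_eq_iff)

lemmas matrix_distribs = matrix_diff_ldistrib matrix_diff_rdistrib matrix_add_ldistrib
  matrix_plus_rdistrib

lemma matrix_scaleR_right:
  fixes A :: "complex^'n^'m"
  shows "A ** (t *\<^sub>R X) = t *\<^sub>R (A ** X)"
  by (simp add: matrix_matrix_mult_def vec_eq_iff scaleR_sum_right)

lemma matrix_scaleR_left:
  fixes A :: "complex^'n^'m"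
  shows "(t *\<^sub>R A) ** X = t *\<^sub>R (A ** X)"
  by (simp add: matrix_matrix_mult_def vec_eq_iff scaleR_sum_right)

lemma inner_hermitian: "hermitian A \<Longrightarrow> (A ** X) \<bullet> Y = X \<bullet> (A ** Y)"
  by (simp add: inner_adjoint_left hermitian_def)

lemma inner_hermitian_right: "hermitian A \<Longrightarrow> (X ** A) \<bullet> Y = X \<bullet> (Y ** A)"
  by (simp add: inner_adjoint_right hermitian_def)

lemma inner_vec_hermitian: "hermitian A \<Longrightarrow> (A *v x) \<bullet> y = x \<bullet> (A *v y)"
  by (simp add: inner_vec_adjoint hermitian_def)

lemma norm_orthogonal_projector:
  assumes "orthogonal_projector p"
  shows "norm (p ** X) \<le> norm X"
proof -
  have "(norm (p ** X))^2 = X \<bullet> (p ** X)"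
    using assms by (simp add: power2_norm_eq_inner orthogonal_projector_def inner_hermitian matrix_mul_assoc)
  also have "\<dots> \<le> norm X * norm (p ** X)" by (rule norm_cauchy_schwarz)
  finally have "norm (p ** X) * norm (p ** X) \<le> norm X * norm (p ** X)"
    by (simp add: power2_eq_square)
  then show ?thesis
    by (cases "norm (p ** X) = 0") (auto simp: mult_le_cancel_right)
qed

lemma orthogonal_projector_complement:
  assumes "orthogonal_projector p"
  shows "orthogonal_projector (mat 1 - p)"
  using assms by (simp add: orthogonal_projector_def hermitian_def conj_transpose_diff matrix_distribs)

lemma spectral_norm_pos:
  fixes X :: "complex^'n^'n"
  assumes "X \<noteq> 0"
  shows "0 < spectral_norm X"
proof -
  obtain x where "X *v x \<noteq> 0 *v x" using assms matrix_eq[of X 0] by blast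
  then have "0 < norm (X *v x)" by simp
  then have "0 < spectral_norm X * norm x" using spectral_norm_bound[of X x] by linarith
  then show ?thesis by (metis norm_ge_zero zero_less_mult_pos2 mult_zero_right less_le)
qed

lemma matrix_vector_sum: "A *v (\<Sum>v\<in>S. f v) = (\<Sum>v\<in>S. A *v f v)" for A :: "complex^'n^'m"
  by (induction S rule: infinite_finite_induct) (simp_all add: matrix_vector_right_distrib)

text \<open>The form in which every Cauchy-Schwarz inequality for a semidefinite form is used below, for forms on
  vectors as well as on matrices.\<close>

lemma quadratic_nonneg_discriminant:
  fixes a b c :: real
  assumes "\<And>t. 0 \<le> a + 2 * t * b + t^2 * c" and "0 \<le> c"
  shows "b^2 \<le> a * c"
proof (cases "c = 0")
  case True
  have "b = 0"
  proof (rule ccontr)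
    assume "b \<noteq> 0"
    then show False
      using assms(1)[of "- (a + 1) / (2 * b)"] True by (simp add: field_simps)
  qed
  then show ?thesis using True by simp
next
  case False
  with assms(2) have "c > 0" by simp
  then show ?thesis
    using assms(1)[of "- b / c"] by (simp add: field_simps power2_eq_square)
qed

lemma matrix_vector_scaleR:
  fixes A :: "complex^'n^'m"
  shows "A *v (t *\<^sub>R x) = t *\<^sub>R (A *v x)"
  by (simp add: matrix_vector_mult_def vec_eq_iff scaleR_sum_right)

section \<open>The compression error\<close>

lemma pseudoinverse_eqI:
  assumes "A ** X ** A = A" "X ** A ** X = X" "hermitian (A ** X)" "hermitian (X ** A)"
  shows "pseudoinverse A = X"
proof -
  have "Y = X" if Y: "A ** Y ** A = A" "Y ** A ** Y = Y" "hermitian (A ** Y)" "hermitian (Y ** A)" for Y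
  proof -
    have "A ** Y = A ** X ** (A ** Y)" using assms(1) by (simp add: matrix_mul_assoc)
    also have "\<dots> = conj_transpose (A ** Y ** (A ** X))"
      using assms(3) Y(3) by (simp add: hermitian_def conj_transpose_mult[of "A ** Y"])
    also have "\<dots> = A ** X"
      using Y(1) assms(3) by (simp add: matrix_mul_assoc hermitian_def)
    finally have left: "A ** Y = A ** X" .
    have "Y ** A = Y ** A ** (X ** A)" using assms(1) by (simp add: matrix_mul_assoc[symmetric])
    also have "\<dots> = conj_transpose (X ** A ** (Y ** A))"
      using assms(4) Y(4) by (simp add: hermitian_def conj_transpose_mult[of "X ** A"])
    also have "\<dots> = X ** A"
      using Y(1) assms(4) by (simp add: matrix_mul_assoc[symmetric] hermitian_def)
    finally have right: "Y ** A = X ** A" .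
    show ?thesis using Y(2) assms(2) left right by (metis matrix_mul_assoc)
  qed
  with assms show ?thesis unfolding pseudoinverse_def by (intro the_equality) blast+
qed

text \<open>The matrix \<open>J = Q ** B ** Q - (mat 1 - Q)\<close> is negative definite, hence invertible, and commutes with
  \<open>Q\<close>; the Penrose equations hold for \<open>J\<^sup>-\<^sup>1 ** Q\<close>, the inverse of \<open>Q ** B ** Q\<close> on the range of \<open>Q\<close>.\<close>

lemma pseudoinverse_compression:
  assumes B: "negative_definite B" and Q: "orthogonal_projector Q"
  defines "X \<equiv> pseudoinverse (Q ** B ** Q)"
  shows "Q ** B ** Q ** X = Q" "X ** (Q ** B ** Q) = Q" "Q ** X = X" "X ** Q = X" "hermitian X"
proof -
  have QQ: "Q ** Q = Q" and hQ: "hermitian Q" using Q by (auto simp: orthogonal_projector_def)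
  have hB: "hermitian B" using B by (simp add: negative_definite_def)
  define C where "C = Q ** B ** Q"
  \<comment> \<open>Subtracting \<open>mat 1 - Q\<close> makes \<open>C\<close> definite on the kernel of \<open>Q\<close> without changing it on the range.\<close>
  define J where "J = C - (mat 1 - Q)"
  have QC: "Q ** C = C" "C ** Q = C"
    using QQ by (simp_all add: C_def matrix_mul_assoc) (simp_all flip: matrix_mul_assoc)
  have QJ: "Q ** J = C" "J ** Q = C"
    using QQ QC by (simp_all add: J_def matrix_distribs)
  have "x = 0" if "J *v x = 0" for x
  proof -
    have "C *v x = 0"
      using QJ(1) that by (metis matrix_vector_mul_assoc matrix_vector_mult_0_right)
    then have "x \<bullet> (C *v x) = 0" by simp
    then have "(Q *v x) \<bullet> (B *v (Q *v x)) = 0"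
      using hQ by (simp add: C_def inner_vec_hermitian matrix_vector_mul_assoc matrix_mul_assoc)
    then have Qx: "Q *v x = 0"
      using B by (force simp: negative_definite_def inner_cdot)
    have "J *v x = C *v x - x + Q *v x"
      by (simp add: J_def matrix_vector_mult_diff_rdistrib)
    then show ?thesis using that \<open>C *v x = 0\<close> Qx by simp
  qed
  then obtain J' where J': "J' ** J = mat 1"
    using matrix_left_invertible_ker by blast
  then have JJ': "J ** J' = mat 1" using matrix_left_right_inverse by blast
  have comm: "J' ** Q = Q ** J'"
  proof -
    have "J' ** Q = J' ** (Q ** J) ** J'"
      using JJ' by (simp flip: matrix_mul_assoc)
    also have "\<dots> = (J' ** J) ** Q ** J'" using QJ by (metis matrix_mul_assoc)
    finally show ?thesis using J' by simp
  qed
  define X0 where "X0 = J' ** Q"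
  have CX: "C ** X0 = Q"
  proof -
    have "C ** X0 = Q ** (J ** J') ** Q" by (simp add: X0_def QJ(1)[symmetric] matrix_mul_assoc)
    then show ?thesis using JJ' QQ by simp
  qed
  have XC: "X0 ** C = Q"
  proof -
    have "X0 ** C = (J' ** J) ** Q" using QC QJ by (simp add: X0_def flip: matrix_mul_assoc)
    then show ?thesis using J' by simp
  qed
  have QX: "Q ** X0 = X0"
    unfolding X0_def using comm QQ by (metis matrix_mul_assoc)
  have XQ: "X0 ** Q = X0"
    using QQ by (simp add: X0_def flip: matrix_mul_assoc)
  have X: "X = X0"
    unfolding X_def C_def[symmetric]
    by (rule pseudoinverse_eqI) (use CX XC QX QC XQ hQ in auto)
  show "Q ** B ** Q ** X = Q" "X ** (Q ** B ** Q) = Q" "Q ** X = X" "X ** Q = X"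
    using CX XC QX XQ by (simp_all add: X C_def[symmetric])
  have hC: "conj_transpose C = C"
    using hQ hB by (simp add: C_def conj_transpose_mult hermitian_def matrix_mul_assoc)
  have "conj_transpose X0 = conj_transpose X0 ** (C ** X0)"
    using QX hQ CX by (metis conj_transpose_mult hermitian_def)
  also have "\<dots> = conj_transpose (C ** X0) ** X0"
    by (simp add: conj_transpose_mult hC matrix_mul_assoc)
  also have "\<dots> = X0" using CX hQ QX by (simp add: hermitian_def)
  finally show "hermitian X" by (simp add: X hermitian_def)
qed

lemma negative_definite_spectral_norm_pos:
  assumes "negative_definite (B::complex^'n^'n)"
  shows "spectral_norm B > 0"
proof -
  obtain x :: "complex^'n" where x: "x \<noteq> 0" using axis_eq_0_iff zero_neq_one by blast
  then have "B *v x \<noteq> 0"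
    using assms by (force simp: negative_definite_def cdot_def)
  then have "0 < norm (B *v x)" by simp
  also have "\<dots> \<le> spectral_norm B * norm x" by (rule spectral_norm_bound)
  finally show ?thesis using x by (simp add: zero_less_mult_iff)
qed

text \<open>Cauchy-Schwarz for the form of \<open>E\<close>, applied to \<open>x\<close> and \<open>E *v x\<close>: it replaces the square root of
  \<open>E\<close> in the proof of \<open>E\<^sup>2 \<le> b E\<close>.\<close>

lemma psd_norm_bound:
  assumes E: "hermitian E" and pos: "\<And>x. 0 \<le> x \<bullet> (E *v x)"
    and le: "\<And>x. x \<bullet> (E *v x) \<le> b * (norm x)^2"
  shows "(norm (E *v x))^2 \<le> b * (x \<bullet> (E *v x))"
proof -
  let ?y = "E *v x"
  have sym: "x \<bullet> (E *v ?y) = ?y \<bullet> ?y" using E by (simp add: inner_vec_hermitian)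
  have "(?y \<bullet> ?y)^2 \<le> (x \<bullet> ?y) * (?y \<bullet> (E *v ?y))"
  proof (rule quadratic_nonneg_discriminant)
    fix t :: real
    have "0 \<le> (x + t *\<^sub>R ?y) \<bullet> (E *v (x + t *\<^sub>R ?y))" by (rule pos)
    also have "\<dots> = x \<bullet> ?y + 2 * t * (?y \<bullet> ?y) + t^2 * (?y \<bullet> (E *v ?y))"
      using sym by (simp add: matrix_vector_right_distrib matrix_vector_scaleR inner_add_left
          inner_add_right algebra_simps power2_eq_square)
    finally show "0 \<le> x \<bullet> ?y + 2 * t * (?y \<bullet> ?y) + t^2 * (?y \<bullet> (E *v ?y))" .
  qed (rule pos)
  also have "\<dots> \<le> (x \<bullet> ?y) * (b * (norm ?y)^2)"
    by (intro mult_left_mono le pos)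
  finally have *: "(norm ?y)^2 * (norm ?y)^2 \<le> (b * (x \<bullet> ?y)) * (norm ?y)^2"
    by (simp only: power2_norm_eq_inner power2_eq_square[of "?y \<bullet> ?y"] mult_ac)
  show ?thesis
  proof (cases "?y = 0")
    case False
    then have "0 < (norm ?y)^2" by simp
    with * show ?thesis by (simp only: mult_le_cancel_right_pos)
  qed simp
qed

text \<open>With \<open>Z\<close> the pseudoinverse of \<open>Q ** B ** Q\<close> and \<open>L = mat 1 - Z ** B\<close>, the relation
  \<open>Z ** B ** Z = Z\<close> gives \<open>E = L\<^sup>* (- B) L\<close>, so \<open>E \<ge> 0\<close>. As \<open>B ** Z ** B \<le> 0\<close>, also
  \<open>E \<le> - B\<close>. The last bound is the one for vectors, summed over the columns of \<open>X\<close>; this keeps the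
  spectral norm of \<open>B\<close> as its constant although matrices carry the Frobenius norm.\<close>

lemma compression_error:
  assumes B: "negative_definite B" and Q: "orthogonal_projector Q"
  defines "E \<equiv> adaptive_compression B Q - B"
  shows "hermitian E" "E ** Q = 0"
    "(norm (E ** X))^2 \<le> spectral_norm B * (X \<bullet> (E ** X))"
proof -
  define Z where "Z = pseudoinverse (Q ** B ** Q)"
  note Z = pseudoinverse_compression[OF B Q, folded Z_def]
  have hB: "hermitian B" using B by (simp add: negative_definite_def)
  have E: "E = B ** Z ** B - B" by (simp add: E_def adaptive_compression_def Z_def)
  show hE: "hermitian E"
    using hB Z(5) by (simp add: E hermitian_def conj_transpose_diff conj_transpose_mult matrix_mul_assoc)
  have "Z ** B ** Q = Q"
    using Z(2,4) by (simp add: matrix_mul_assoc)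
  then show "E ** Q = 0"
    by (simp add: E matrix_distribs flip: matrix_mul_assoc)
  have ZBZ: "Z ** B ** Z = Z"
    using Z by (metis matrix_mul_assoc)
  have nonpos: "x \<bullet> (B *v x) \<le> 0" for x
    using B by (cases "x = 0") (auto simp: negative_definite_def inner_cdot less_imp_le cdot_def)
  have BZB: "x \<bullet> ((B ** Z ** B) *v x) = (Z *v (B *v x)) \<bullet> (B *v (Z *v (B *v x)))" for x
  proof -
    have "(Z *v (B *v x)) \<bullet> (B *v (Z *v (B *v x))) = (B *v x) \<bullet> ((Z ** B ** Z) *v (B *v x))"
      by (subst inner_vec_hermitian[OF Z(5)]) (simp add: matrix_vector_mul_assoc matrix_mul_assoc)
    also have "\<dots> = x \<bullet> ((B ** Z ** B) *v x)"
      unfolding ZBZ by (subst inner_vec_hermitian[OF hB]) (simp add: matrix_vector_mul_assoc matrix_mul_assoc)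
    finally show ?thesis ..
  qed
  have xE: "x \<bullet> (E *v x) = x \<bullet> ((B ** Z ** B) *v x) - x \<bullet> (B *v x)" for x
    by (simp add: E matrix_vector_mult_diff_rdistrib inner_diff_right)
  have pos: "0 \<le> x \<bullet> (E *v x)" for x
  proof -
    let ?z = "Z *v (B *v x)"
    have "0 \<le> - ((x - ?z) \<bullet> (B *v (x - ?z)))" using nonpos by simp
    also have "\<dots> = - (x \<bullet> (B *v x)) + x \<bullet> (B *v ?z) + ?z \<bullet> (B *v x) - ?z \<bullet> (B *v ?z)"
      by (simp add: matrix_vector_mult_diff_distrib inner_diff_left inner_diff_right)
    also have "x \<bullet> (B *v ?z) = x \<bullet> ((B ** Z ** B) *v x)"
      by (simp add: matrix_vector_mul_assoc matrix_mul_assoc)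
    also have "?z \<bullet> (B *v x) = x \<bullet> ((B ** Z ** B) *v x)"
      by (subst inner_vec_hermitian[OF Z(5)], subst inner_vec_hermitian[OF hB])
        (simp add: matrix_vector_mul_assoc matrix_mul_assoc)
    finally show ?thesis by (simp add: xE BZB)
  qed
  have le: "x \<bullet> (E *v x) \<le> spectral_norm B * (norm x)^2" for x
  proof -
    have "x \<bullet> (E *v x) \<le> - (x \<bullet> (B *v x))" using nonpos by (simp add: xE BZB)
    also have "\<dots> \<le> norm x * norm (B *v x)"
      using norm_cauchy_schwarz[of "- x" "B *v x"] by simp
    also have "\<dots> \<le> norm x * (spectral_norm B * norm x)"
      by (intro mult_left_mono spectral_norm_bound) simp
    finally show ?thesis by (simp add: power2_eq_square mult_ac)
  qed
  have "(norm (E ** X))^2 = (\<Sum>j\<in>UNIV. (norm (E *v column j X))^2)"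
    by (simp add: norm_by_columns column_mult)
  also have "\<dots> \<le> (\<Sum>j\<in>UNIV. spectral_norm B * (column j X \<bullet> (E *v column j X)))"
    by (intro sum_mono psd_norm_bound hE pos le)
  also have "\<dots> = spectral_norm B * (X \<bullet> (E ** X))"
    by (simp add: inner_by_columns column_mult sum_distrib_left)
  finally show "(norm (E ** X))^2 \<le> spectral_norm B * (X \<bullet> (E ** X))" .
qed

section \<open>Spectral blocks and their projectors\<close>

text \<open>The range of \<open>p\<close> reduces \<open>H\<close>, with \<open>H \<le> a\<close> on it and \<open>H \<ge> c\<close> on its complement. The bounds are
  stated for matrices \<open>X\<close>, that is for all columns at once, because matrices are the vectors of the
  analysis below.\<close>

definition lowest_block :: "complex^'n^'n \<Rightarrow> complex^'n^'n \<Rightarrow> real \<Rightarrow> real \<Rightarrow> bool" where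
  "lowest_block H p a c \<longleftrightarrow> orthogonal_projector p \<and> H ** p = p ** H \<and>
     (\<forall>X::complex^'n^'n. p ** X = X \<longrightarrow> X \<bullet> (H ** X) \<le> a * (norm X)^2) \<and>
     (\<forall>X::complex^'n^'n. p ** X = 0 \<longrightarrow> c * (norm X)^2 \<le> X \<bullet> (H ** X))"

lemma orthogonal_projectorD:
  assumes "orthogonal_projector p"
  shows "hermitian p" "p ** p = p" "p ** (p ** X) = p ** X" "conj_transpose p = p"
  using assms by (auto simp: orthogonal_projector_def hermitian_def matrix_mul_assoc)

lemma inner_projector_split:
  assumes p: "orthogonal_projector p" and comm: "H ** p = p ** H"
  shows "X \<bullet> (H ** X) = (p ** X) \<bullet> (H ** (p ** X)) + (X - p ** X) \<bullet> (H ** (X - p ** X))"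
proof -
  note p' = orthogonal_projectorD[OF p]
  have 1: "(p ** X) \<bullet> (H ** X) = (p ** X) \<bullet> (H ** (p ** X))"
    using p' comm by (metis inner_hermitian matrix_mul_assoc)
  have 2: "X \<bullet> (H ** (p ** X)) = (p ** X) \<bullet> (H ** (p ** X))"
    using p' comm by (metis inner_hermitian matrix_mul_assoc)
  show ?thesis
    by (simp add: matrix_distribs inner_diff_left inner_diff_right 1 2)
qed

lemma norm_projector_split:
  assumes p: "orthogonal_projector p"
  shows "(norm X)^2 = (norm (p ** X))^2 + (norm (X - p ** X))^2"
  using inner_projector_split[OF p, of "mat 1" X] by (simp add: power2_norm_eq_inner)

lemma norm_projector_diff:
  fixes p R :: "complex^'n^'n"
  assumes p: "orthogonal_projector p" and R: "orthogonal_projector R" and rank: "norm R = norm p"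
  shows "(norm (R - p))^2 = 2 * (norm (R - p ** R))^2"
proof -
  note p' = orthogonal_projectorD[OF p] and R' = orthogonal_projectorD[OF R]
  have pR: "p \<bullet> R = (norm (p ** R))^2"
    unfolding power2_norm_eq_inner
    using p' R' by (metis inner_hermitian inner_hermitian_right inner_commute)
  have "(norm (R - p))^2 = (norm R)^2 + (norm p)^2 - 2 * (p \<bullet> R)"
    by (simp add: power2_norm_eq_inner inner_diff_left inner_diff_right inner_commute)
  then show ?thesis using norm_projector_split[OF p, of R] rank pR by simp
qed

text \<open>Among projectors of a fixed rank, \<open>p\<close> minimises the trace against \<open>H\<close>, with a quadratic margin.
  The rank enters through \<open>norm R = norm p\<close>, as the squared Frobenius norm of a projector is its rank.
  Splitting along \<open>p\<close>, the trace of \<open>R\<close> gains at least \<open>c\<close> times what lies outside the range of \<open>p\<close> and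
  loses at most \<open>a\<close> times what is missing inside; the two amounts agree because the ranks do.\<close>

lemma ky_fan:
  fixes H p R :: "complex^'n^'n"
  assumes H: "lowest_block H p a c"
    and R: "orthogonal_projector R" and rank: "norm R = norm p"
  shows "p \<bullet> H + (c - a) / 2 * (norm (R - p))^2 \<le> R \<bullet> H"
proof -
  have p: "orthogonal_projector p" and comm: "H ** p = p ** H"
    and up: "\<And>X::complex^'n^'n. p ** X = X \<Longrightarrow> X \<bullet> (H ** X) \<le> a * (norm X)^2"
    and lo: "\<And>X::complex^'n^'n. p ** X = 0 \<Longrightarrow> c * (norm X)^2 \<le> X \<bullet> (H ** X)"
    using H by (auto simp: lowest_block_def)
  note p' = orthogonal_projectorD[OF p] and R' = orthogonal_projectorD[OF R]
  define X V Z where "X = p ** R" and "V = p - p ** R" and "Z = R - p ** R"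
  have RH: "R \<bullet> H = R \<bullet> (H ** R)"
    using inner_hermitian_right[OF R'(1), of R H] R'(2) by simp
  have pH: "p \<bullet> H = p \<bullet> (H ** p)"
    using inner_hermitian_right[OF p'(1), of p H] p'(2) by simp
  have split: "R \<bullet> H = X \<bullet> (H ** X) + Z \<bullet> (H ** Z)"
    unfolding RH X_def Z_def by (rule inner_projector_split[OF p comm])
  have XR: "X ** R = X" and VR: "V ** R = 0"
    using R'(2) by (simp_all add: X_def V_def matrix_distribs flip: matrix_mul_assoc)
  have XV: "X \<bullet> (H ** V) = 0"
  proof -
    have "X \<bullet> (H ** V) = (X ** R) \<bullet> (H ** V)" by (simp only: XR)
    also have "\<dots> = X \<bullet> (H ** (V ** R))" by (simp add: inner_hermitian_right[OF R'(1)] flip: matrix_mul_assoc)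
    finally show ?thesis by (simp add: VR)
  qed
  have VX: "V \<bullet> (H ** X) = 0"
  proof -
    have "V \<bullet> (H ** X) = V \<bullet> (H ** X ** R)" by (simp add: XR flip: matrix_mul_assoc)
    also have "\<dots> = (V ** R) \<bullet> (H ** X)" by (simp only: inner_hermitian_right[OF R'(1)])
    finally show ?thesis by (simp add: VR)
  qed
  have "p = X + V" by (simp add: X_def V_def)
  then have "p \<bullet> H = (X + V) \<bullet> (H ** (X + V))" using pH by simp
  also have "\<dots> = X \<bullet> (H ** X) + V \<bullet> (H ** V)"
    by (simp add: matrix_distribs inner_add_left inner_add_right XV VX)
  finally have pH': "p \<bullet> H = X \<bullet> (H ** X) + V \<bullet> (H ** V)" .
  have "p ** V = V" and "p ** Z = 0"
    by (simp_all add: V_def Z_def matrix_distribs p'(2,3))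
  then have V: "V \<bullet> (H ** V) \<le> a * (norm V)^2" and Z: "c * (norm Z)^2 \<le> Z \<bullet> (H ** Z)"
    using up lo by auto
  have VV: "(norm V)^2 = (norm p)^2 - (norm X)^2"
  proof -
    have "p \<bullet> X = X \<bullet> X" unfolding X_def using p' R' by (metis inner_hermitian inner_hermitian_right inner_commute)
    then show ?thesis
      by (simp add: V_def X_def power2_norm_eq_inner inner_diff_left inner_diff_right inner_commute)
  qed
  \<comment> \<open>What \<open>R\<close> has outside the range of \<open>p\<close> equals in norm what it lacks inside.\<close>
  have nV: "(norm V)^2 = (norm Z)^2"
    using VV norm_projector_split[OF p, of R] rank by (simp add: X_def Z_def)
  have "(norm (R - p))^2 = 2 * (norm Z)^2"
    unfolding Z_def by (rule norm_projector_diff[OF p R rank])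
  then have "(c - a) / 2 * (norm (R - p))^2 = c * (norm Z)^2 - a * (norm Z)^2"
    by (simp add: left_diff_distrib)
  then show ?thesis using split pH' V Z unfolding nV by linarith
qed

text \<open>With \<open>Z = p - P ** p\<close> one has \<open>H ** Z = Z ** H\<close>: this is at least \<open>c'\<close> seen from the left
  and at most \<open>a\<close> seen from the right, so \<open>Z = 0\<close>.\<close>

lemma lowest_block_nested:
  fixes H p P :: "complex^'n^'n"
  assumes H: "hermitian H" and p: "lowest_block H p a c" and P: "lowest_block H P a' c'" and gap: "a < c'"
  shows "P ** p = p"
proof -
  have op: "orthogonal_projector p" "orthogonal_projector P" and comm: "H ** p = p ** H" "H ** P = P ** H"
    using p P by (auto simp: lowest_block_def)
  note p' = orthogonal_projectorD[OF op(1)] and P' = orthogonal_projectorD[OF op(2)]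
  define Z where "Z = p - P ** p"
  have "P ** Z = 0" by (simp add: Z_def matrix_distribs P')
  then have 1: "c' * (norm Z)^2 \<le> Z \<bullet> (H ** Z)" using P by (simp add: lowest_block_def)
  have "p ** conj_transpose Z = conj_transpose Z"
    by (simp add: Z_def conj_transpose_diff conj_transpose_mult p' P' matrix_distribs)
  then have 2: "conj_transpose Z \<bullet> (H ** conj_transpose Z) \<le> a * (norm Z)^2"
    using p by (auto simp: lowest_block_def dest!: spec[of _ "conj_transpose Z"])
  have "H ** Z = Z ** H"
    unfolding Z_def matrix_diff_ldistrib matrix_diff_rdistrib using comm by (metis matrix_mul_assoc)
  then have "Z \<bullet> (H ** Z) = conj_transpose Z \<bullet> (H ** conj_transpose Z)"
    using inner_conj_transpose[of Z "Z ** H"] H by (simp add: conj_transpose_mult hermitian_def)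
  with 1 2 have "(c' - a) * (norm Z)^2 \<le> 0" by (simp add: left_diff_distrib)
  then have "norm Z = 0" using gap by (simp add: mult_le_0_iff)
  then show ?thesis by (simp add: Z_def)
qed

text \<open>Kato's matrix \<open>J = p ** R + (mat 1 - p) ** (mat 1 - R)\<close> intertwines the projectors,
  \<open>J ** R = p ** J\<close>, and is near the identity if \<open>R\<close> is near \<open>p\<close>. Hence \<open>F = J\<^sup>-\<^sup>1 ** p\<close> is the projector
  onto the range of \<open>R\<close> along the kernel of \<open>p\<close>.\<close>

lemma oblique_projector:
  fixes p R :: "complex^'n^'n"
  assumes p: "orthogonal_projector p" and R: "orthogonal_projector R"
    and close: "norm (R - p) \<le> 1 / 4"
  obtains F where "p ** F = p" "F ** p = F" "R ** F = F" "F ** R = R" "norm F \<le> 2 * norm p"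
proof -
  note p' = orthogonal_projectorD[OF p] and R' = orthogonal_projectorD[OF R]
  define J where "J = p ** R + (mat 1 - p) ** (mat 1 - R)"
  have JX: "J ** X = p ** (R ** X) + (mat 1 - p) ** (X - R ** X)" for X :: "complex^'n^'n"
    by (simp add: J_def matrix_plus_rdistrib matrix_diff_rdistrib flip: matrix_mul_assoc)
  have diff: "X - J ** X = p ** ((p - R) ** X) + (R - p) ** (R ** X)" for X :: "complex^'n^'n"
    by (simp add: JX matrix_distribs p' R' flip: matrix_mul_assoc)
  have near: "norm (X - J ** X) \<le> 1 / 2 * norm X" for X :: "complex^'n^'n"
  proof -
    have "norm (p ** ((p - R) ** X)) \<le> norm (p - R) * norm X"
      by (rule order_trans[OF norm_orthogonal_projector[OF p] norm_matrix_mult])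
    also have "\<dots> \<le> 1 / 4 * norm X"
      using close by (intro mult_right_mono) (auto simp: norm_minus_commute)
    finally have 1: "norm (p ** ((p - R) ** X)) \<le> 1 / 4 * norm X" .
    have "norm ((R - p) ** (R ** X)) \<le> norm (R - p) * norm (R ** X)" by (rule norm_matrix_mult)
    also have "\<dots> \<le> 1 / 4 * norm X"
      using close by (intro mult_mono norm_orthogonal_projector[OF R]) auto
    finally show ?thesis using 1 norm_triangle_ineq[of "p ** ((p - R) ** X)" "(R - p) ** (R ** X)"]
      by (simp add: diff)
  qed
  have "x = 0" if "J *v x = 0" for x
  proof -
    define X :: "complex^'n^'n" where "X = (\<chi> i j. x $ i)"
    have "J ** X = (\<chi> i j. (J *v x) $ i)"
      by (simp add: X_def matrix_matrix_mult_def matrix_vector_mult_def)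
    then have "J ** X = 0" using that by (simp add: vec_eq_iff)
    then have "X = 0" using near[of X] by simp
    then show ?thesis by (simp add: X_def vec_eq_iff)
  qed
  then obtain J' where J': "J' ** J = mat 1"
    using matrix_left_invertible_ker by blast
  then have JJ': "J ** J' = mat 1" using matrix_left_right_inverse by blast
  have JR: "J ** R = p ** R"
    by (simp add: JX R')
  have pJ: "p ** J = p ** R"
    by (simp add: J_def matrix_add_ldistrib matrix_mul_assoc matrix_diff_ldistrib[of p _ p] p')
  define F where "F = J' ** p"
  have JF: "J ** F = p" using JJ' by (simp add: F_def matrix_mul_assoc)
  have FR: "F ** R = R"
    unfolding F_def using JR J' by (metis matrix_mul_assoc matrix_mul_lid)
  have RF: "R ** F = F"
  proof -
    have "J' ** p = J' ** (p ** J) ** J'" using JJ' by (simp flip: matrix_mul_assoc)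
    also have "\<dots> = (J' ** J) ** R ** J'" unfolding pJ JR[symmetric] by (simp add: matrix_mul_assoc)
    finally have F: "F = R ** J'" using J' by (simp add: F_def)
    show ?thesis unfolding F by (rule R'(3))
  qed
  show ?thesis
  proof (rule that)
    have "p ** F = p ** J ** F"
      by (metis pJ RF matrix_mul_assoc)
    also have "\<dots> = p" using JF p'(2) by (simp flip: matrix_mul_assoc)
    finally show "p ** F = p" .
    show "F ** p = F" using p'(2) by (simp add: F_def flip: matrix_mul_assoc)
    have "norm (F - p) \<le> 1 / 2 * norm F" using near[of F] by (simp add: JF)
    then show "norm F \<le> 2 * norm p"
      using norm_triangle_sub[of F p] by simp
  qed (use RF FR in auto)
qed

section \<open>Eigenvalues of Hermitian matrices\<close>

lemma cdot_add_right: "cdot u (x + y) = cdot u x + cdot u y"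
  by (simp add: cdot_def algebra_simps sum.distrib)
lemma cdot_diff_right: "cdot u (x - y) = cdot u x - cdot u y"
  by (simp add: cdot_def algebra_simps sum_subtractf)
lemma cdot_scale_right: "cdot u (c *s x) = c * cdot u x"
  by (simp add: cdot_def sum_distrib_left mult_ac)
lemma cdot_scaleR_right: "cdot u (t *\<^sub>R x) = complex_of_real t * cdot u x"
  by (simp add: cdot_def sum_distrib_left mult_ac scaleR_conv_of_real[where 'a=complex])
lemma cdot_zero_right [simp]: "cdot u 0 = 0" by (simp add: cdot_def)
lemma cdot_sum_right: "cdot u (\<Sum>i\<in>S. f i) = (\<Sum>i\<in>S. cdot u (f i))"
  by (induction S rule: infinite_finite_induct) (simp_all add: cdot_add_right)
lemma cnj_cdot: "cnj (cdot x y) = cdot y x"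
  by (simp add: cdot_def mult.commute)
lemma cdot_self: "cdot x x = of_real ((norm x)^2)"
proof -
  have "Im (cdot x x) = 0"
    by (simp add: cdot_def)
  then show ?thesis by (simp add: complex_eq_iff power2_norm_eq_inner inner_cdot)
qed
lemma cdot_adjoint: "cdot (A *v x) y = cdot x (conj_transpose A *v y)"
    unfolding cdot_def matrix_vector_mult_def conj_transpose_def
    by (simp add: sum_distrib_left sum_distrib_right mult_ac)  (rule sum.swap)
lemma cdot_hermitian: "hermitian A \<Longrightarrow> cdot (A *v x) y = cdot x (A *v y)"
  by (simp add: cdot_adjoint hermitian_def)

lemma matrix_vector_smult: "A *v (c *s x) = c *s (A *v x)" for A :: "complex^'n^'m"
  by (simp add: matrix_vector_mult_def vec_eq_iff sum_distrib_left mult_ac)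

lemma scaleR_eq_smult: "t *\<^sub>R x = complex_of_real t *s x"
  by (simp add: vec_eq_iff scaleR_conv_of_real[where 'a=complex])

text \<open>A minimiser of the Rayleigh quotient on the unit sphere of \<open>W\<close> is an eigenvector. The
  variations are real multiples of the residual \<open>y\<close>, which itself lies in \<open>W\<close>.\<close>

lemma invariant_subspace_has_eigenvector:
  fixes H :: "complex^'n^'n"
  assumes H: "hermitian H" and W: "subspace W" and inv: "\<And>x. x \<in> W \<Longrightarrow> H *v x \<in> W"
    and x0: "x0 \<in> W" "x0 \<noteq> 0"
  obtains v \<mu> where "v \<in> W" "norm v = 1" "H *v v = complex_of_real \<mu> *s v"
proof -
  let ?S = "sphere 0 1 \<inter> W" and ?q = "\<lambda>x. x \<bullet> (H *v x)"
  have "compact ?S" by (intro compact_Int_closed closed_subspace W) simp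
  moreover have "(1 / norm x0) *\<^sub>R x0 \<in> ?S" using x0 W by (simp add: subspace_scale)
  then have "?S \<noteq> {}" by blast
  moreover have "continuous_on ?S ?q"
    by (intro continuous_intros linear_continuous_on matrix_vector_mul_bounded_linear)
  ultimately have "\<exists>v\<in>?S. \<forall>x\<in>?S. ?q v \<le> ?q x" by (intro continuous_attains_inf)
  then obtain v where v: "v \<in> ?S" and min: "\<And>x. x \<in> ?S \<Longrightarrow> ?q v \<le> ?q x" by blast
  have nv: "norm v = 1" and vW: "v \<in> W" using v by auto
  define \<mu> where "\<mu> = ?q v"
  have ge: "\<mu> * (norm x)^2 \<le> ?q x" if "x \<in> W" for x
  proof (cases "x = 0")
    case False
    then have "(1 / norm x) *\<^sub>R x \<in> ?S" using that W by (simp add: subspace_scale)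
    then have "\<mu> \<le> ?q ((1 / norm x) *\<^sub>R x)" unfolding \<mu>_def by (rule min)
    also have "\<dots> = ?q x / (norm x)^2" by (simp add: matrix_vector_scaleR power2_eq_square)
    finally show ?thesis using False by (simp add: field_simps)
  qed simp
  define y where "y = H *v v - \<mu> *\<^sub>R v"
  have yW: "y \<in> W" unfolding y_def using W vW inv by (intro subspace_diff subspace_scale) auto
  have vHy: "v \<bullet> (H *v y) = y \<bullet> (H *v v)" using H by (metis inner_commute inner_vec_hermitian)
  have "(y \<bullet> y)^2 \<le> 0 * (y \<bullet> (H *v y) - \<mu> * (norm y)^2)"
  proof (rule quadratic_nonneg_discriminant)
    show "0 \<le> y \<bullet> (H *v y) - \<mu> * (norm y)^2" using ge[OF yW] by simp
    fix t :: real
    have "v + t *\<^sub>R y \<in> W" using W vW yW by (intro subspace_add subspace_scale)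
    from ge[OF this] have "0 \<le> ?q (v + t *\<^sub>R y) - \<mu> * ((v + t *\<^sub>R y) \<bullet> (v + t *\<^sub>R y))"
      by (simp add: power2_norm_eq_inner)
    also have "\<dots> = ?q v - \<mu> * (v \<bullet> v) + 2 * t * (y \<bullet> (H *v v) - \<mu> * (y \<bullet> v))
        + t^2 * (?q y - \<mu> * (y \<bullet> y))"
      by (simp add: matrix_vector_right_distrib matrix_vector_scaleR inner_add_left inner_add_right
          vHy inner_commute[of v y] algebra_simps power2_eq_square)
    also have "?q v - \<mu> * (v \<bullet> v) = 0" using nv by (simp add: \<mu>_def flip: power2_norm_eq_inner)
    also have "y \<bullet> (H *v v) - \<mu> * (y \<bullet> v) = y \<bullet> y" by (simp add: y_def inner_diff_right)
    finally show "0 \<le> 0 + 2 * t * (y \<bullet> y) + t\<^sup>2 * (?q y - \<mu> * (norm y)^2)"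
      by (simp add: power2_norm_eq_inner)
  qed
  then have "y = 0" by simp
  then show ?thesis using that[OF vW nv, of \<mu>] by (simp add: y_def scaleR_eq_smult)
qed

definition orthonormal :: "(complex^'n) set \<Rightarrow> bool" where
  "orthonormal S \<longleftrightarrow> (\<forall>u\<in>S. \<forall>v\<in>S. cdot u v = (if u = v then 1 else 0))"

lemma cdot_span_eq_0:
  assumes "x \<in> vec.span S" and "\<And>v. v \<in> S \<Longrightarrow> cdot u v = 0"
  shows "cdot u x = 0"
  using assms(1)
  by (induction rule: vec.span_induct_alt) (simp_all add: cdot_add_right cdot_scale_right assms(2))

lemma orthonormal_independent:
  assumes "orthonormal S" shows "vec.independent S"
  unfolding vec.dependent_def
proof safe
  fix u assume u: "u \<in> S" "u \<in> vec.span (S - {u})"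
  have "cdot u u = 0"
    by (rule cdot_span_eq_0[OF u(2)]) (use assms u(1) in \<open>auto simp: orthonormal_def\<close>)
  then show False using u assms by (simp add: orthonormal_def)
qed

lemma orthonormal_finite: "orthonormal S \<Longrightarrow> finite S"
  by (rule vec.finiteI_independent[OF orthonormal_independent])

lemma orthonormal_expansion_span:
  assumes S: "orthonormal S" and x: "x \<in> vec.span S"
  shows "x = (\<Sum>u\<in>S. cdot u x *s u)"
  using x
proof (induction rule: vec.span_induct_alt)
  case base then show ?case by simp
next
  case (step c v y)
  have "(\<Sum>u\<in>S. cdot u (c *s v + y) *s u) = c *s (\<Sum>u\<in>S. cdot u v *s u) + (\<Sum>u\<in>S. cdot u y *s u)"
    by (simp add: cdot_add_right cdot_scale_right sum.distrib vec.scale_sum_right vec.scale_left_distrib)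
  also have "(\<Sum>u\<in>S. cdot u v *s u) = (\<Sum>u\<in>S. if u = v then v else 0)"
    using S step by (intro sum.cong) (auto simp: orthonormal_def)
  also have "\<dots> = v" using orthonormal_finite[OF S] step by simp
  finally show ?case using step by simp
qed

text \<open>The spectral theorem, in the form that also completes a given system of eigenvectors: in a maximal
  orthonormal system of eigenvectors nothing is left over, since the orthogonal complement is invariant
  and would contain a further eigenvector.\<close>

lemma extend_orthonormal_eigenvectors:
  fixes H :: "complex^'n^'n"
  assumes H: "hermitian H" and S: "orthonormal S"
    and eig: "\<forall>u\<in>S. \<exists>\<mu>. H *v u = complex_of_real \<mu> *s u"
  obtains T where "S \<subseteq> T" "orthonormal T" "card T = CARD('n)"
    "\<forall>u\<in>T. \<exists>\<mu>. H *v u = complex_of_real \<mu> *s u" "\<And>x. x = (\<Sum>u\<in>T. cdot u x *s u)"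
proof -
  let ?P = "\<lambda>T. S \<subseteq> T \<and> orthonormal T \<and> (\<forall>u\<in>T. \<exists>\<mu>. H *v u = complex_of_real \<mu> *s u)"
  have bound: "card T \<le> CARD('n)" if "orthonormal T" for T :: "(complex^'n) set"
    using vec.independent_card_le_dim[OF subset_UNIV orthonormal_independent[OF that]]
    unfolding vec_dim_card .
  then have "\<exists>T. ?P T \<and> (\<forall>T'. ?P T' \<longrightarrow> card T' \<le> card T)"
    using S eig by (intro ex_has_greatest_nat[where b="Suc CARD('n)" and k=S]) (auto simp: less_Suc_eq_le)
  then obtain T where T: "?P T" and max: "\<And>T'. ?P T' \<Longrightarrow> card T' \<le> card T" by blast
  have oT: "orthonormal T" and fT: "finite T" using T orthonormal_finite by auto
  have span: "x \<in> vec.span T" for x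
  proof (rule ccontr)
    assume x: "x \<notin> vec.span T"
    define W where "W = {y. \<forall>u\<in>T. cdot u y = 0}"
    define x0 where "x0 = x - (\<Sum>u\<in>T. cdot u x *s u)"
    have in_span: "(\<Sum>u\<in>T. cdot u x *s u) \<in> vec.span T"
      by (intro vec.span_sum vec.span_scale vec.span_base)
    have "x0 \<in> W"
    proof -
      have "cdot v x0 = 0" if v: "v \<in> T" for v
      proof -
        have "cdot v x0 = cdot v x - (\<Sum>u\<in>T. cdot u x * cdot v u)"
          by (simp add: x0_def cdot_diff_right cdot_sum_right cdot_scale_right)
        also have "(\<Sum>u\<in>T. cdot u x * cdot v u) = (\<Sum>u\<in>T. if u = v then cdot v x else 0)"
          using oT v by (intro sum.cong) (auto simp: orthonormal_def)
        finally show ?thesis using v fT by simp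
      qed
      then show ?thesis by (simp add: W_def)
    qed
    moreover have "x0 \<noteq> 0" using x in_span by (auto simp: x0_def)
    moreover have "subspace W"
      by (auto simp: subspace_def W_def cdot_add_right cdot_scaleR_right)
    moreover have "H *v y \<in> W" if "y \<in> W" for y
    proof -
      have "cdot u (H *v y) = 0" if u: "u \<in> T" for u
      proof -
        obtain \<mu> where "H *v u = complex_of_real \<mu> *s u" using T u by blast
        then have "cdot (H *v u) y = cnj (of_real \<mu>) * cdot u y"
          by (simp add: cdot_def sum_distrib_left mult_ac)
        then show ?thesis using cdot_hermitian[OF H, of u y] \<open>y \<in> W\<close> u by (simp add: W_def)
      qed
      then show ?thesis by (simp add: W_def)
    qed
    ultimately obtain v \<mu> where v: "v \<in> W" "norm v = 1" "H *v v = complex_of_real \<mu> *s v"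
      using invariant_subspace_has_eigenvector[OF H] by blast
    have vv: "cdot v v = 1" using v by (simp add: cdot_self)
    have uv: "cdot u v = 0" "cdot v u = 0" if "u \<in> T" for u
      using v that cnj_cdot[of u v] by (auto simp: W_def)
    have "v \<notin> T" using vv uv by auto
    moreover have "?P (insert v T)" using T uv vv v by (auto simp: orthonormal_def)
    then have "card (insert v T) \<le> card T" by (rule max)
    ultimately show False using fT by simp
  qed
  have "card T = CARD('n)"
    using vec.dim_eq_card_independent[OF orthonormal_independent[OF oT]] span
    by (metis UNIV_eq_I vec.dim_span vec_dim_card)
  with T span orthonormal_expansion_span[OF oT] show ?thesis by (intro that[of T]) auto
qed

lemma const_poly_sum: "(\<Sum>k\<in>S. [:f k:]) = [:\<Sum>k\<in>S. f k:]" for f :: "'k \<Rightarrow> complex"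
  by (induction S rule: infinite_finite_induct) simp_all

text \<open>Diagonalisation over the polynomial ring: the matrix \<open>XH\<close> of the characteristic polynomial is
  intertwined with a diagonal matrix \<open>D\<close> by the constant matrix \<open>U\<close> of eigenvectors, whose determinant
  is nonzero.\<close>

lemma charpoly_eigenbasis:
  fixes H :: "complex^'n^'n" and w :: "'n \<Rightarrow> complex^'n"
  assumes on: "\<And>i j. cdot (w i) (w j) = (if i = j then 1 else 0)"
    and eig: "\<And>j. H *v w j = complex_of_real (\<mu> j) *s w j"
  shows "charpoly H = (\<Prod>j\<in>UNIV. [:- complex_of_real (\<mu> j), 1:])"
proof -
  define XH :: "complex poly^'n^'n" where
    "XH = (\<chi> i j. (if i = j then [:0, 1:] else 0) - [:vec_nth (vec_nth H i) j:])"
  define U :: "complex poly^'n^'n" where "U = (\<chi> i j. [:vec_nth (w j) i:])"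
  define V :: "complex poly^'n^'n" where "V = (\<chi> i j. [:cnj (vec_nth (w i) j):])"
  define D :: "complex poly^'n^'n" where
    "D = (\<chi> i j. if i = j then [:- complex_of_real (\<mu> j), 1:] else 0)"
  have on': "(\<Sum>k\<in>UNIV. vec_nth (w j) k * cnj (vec_nth (w i) k)) = (if i = j then 1 else 0)" for i j
    using on[of i j] by (simp add: cdot_def mult.commute)
  have "V ** U = mat 1"
    by (simp add: V_def U_def vec_eq_iff matrix_matrix_mult_def mat_def const_poly_sum on' mult.commute one_pCons)
  then have "det V * det U = 1" by (metis det_I det_mul)
  then have nz: "det U \<noteq> 0" by auto
  have "XH ** U = U ** D"
  proof -
    have "(\<Sum>k\<in>UNIV. ((if i = k then [:0, 1:] else 0) - [:vec_nth (vec_nth H i) k:]) * [:vec_nth (w j) k:])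
        = (\<Sum>k\<in>UNIV. [:vec_nth (w k) i:] * (if k = j then [:- complex_of_real (\<mu> j), 1:] else 0))" for i j
    proof -
      have "(\<Sum>k\<in>UNIV. vec_nth (vec_nth H i) k * vec_nth (w j) k) = complex_of_real (\<mu> j) * vec_nth (w j) i"
        using eig[of j] by (simp add: vec_eq_iff matrix_vector_mult_def)
      moreover have "((if i = k then [:0, 1:] else 0) - [:vec_nth (vec_nth H i) k:]) * [:vec_nth (w j) k:]
        = (if i = k then [:0, vec_nth (w j) k:] else 0) - [:vec_nth (vec_nth H i) k * vec_nth (w j) k:]" for k
        by simp
      moreover have "[:vec_nth (w k) i:] * (if k = j then [:- complex_of_real (\<mu> j), 1:] else 0)
        = (if k = j then [:- complex_of_real (\<mu> j) * vec_nth (w j) i, vec_nth (w j) i:] else 0)" for k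
        by simp
      ultimately show ?thesis
        by (simp only: sum_subtractf const_poly_sum) simp
    qed
    then show ?thesis
      by (simp add: XH_def U_def D_def vec_eq_iff matrix_matrix_mult_def)
  qed
  then have "det XH * det U = det U * det D" by (metis det_mul)
  then have "det XH = det D" using nz by (simp add: mult.commute)
  also have "det D = (\<Prod>j\<in>UNIV. [:- complex_of_real (\<mu> j), 1:])"
    by (subst det_diagonal) (simp_all add: D_def)
  finally show ?thesis by (simp add: charpoly_def XH_def)
qed

lemma charpoly_roots_eigenbasis:
  fixes H :: "complex^'n^'n"
  assumes T: "orthonormal T" "card T = CARD('n)" and eig: "\<And>u. u \<in> T \<Longrightarrow> H *v u = complex_of_real (\<mu> u) *s u"
  shows "image_mset Re (proots (charpoly H)) = image_mset \<mu> (mset_set T)"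
proof -
  obtain w where w: "bij_betw w (UNIV :: 'n set) T"
    using T orthonormal_finite[OF T(1)] by (metis finite_same_card_bij finite_class.finite_UNIV)
  have wT: "w j \<in> T" for j using w by (auto simp: bij_betw_def)
  have "w i = w j \<longleftrightarrow> i = j" for i j using w by (auto simp: bij_betw_def inj_on_def)
  then have "charpoly H = (\<Prod>j\<in>UNIV. [:- complex_of_real (\<mu> (w j)), 1:])"
    using T wT eig by (intro charpoly_eigenbasis[where w=w and \<mu>="\<lambda>j. \<mu> (w j)"]) (auto simp: orthonormal_def)
  then have "proots (charpoly H) = (\<Sum>j\<in>UNIV. {#complex_of_real (\<mu> (w j))#})"
    by (simp add: proots_prod)
  also have "\<dots> = image_mset (\<lambda>j. complex_of_real (\<mu> (w j))) (mset_set UNIV)"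
    by (simp add: sum_unfold_sum_mset)
  finally have "image_mset Re (proots (charpoly H)) = image_mset \<mu> (image_mset w (mset_set UNIV))"
    by (simp add: image_mset.compositionality o_def)
  also have "image_mset w (mset_set UNIV) = mset_set T"
    using w by (simp add: image_mset_mset_set bij_betw_def)
  finally show ?thesis .
qed

text \<open>The list is independent of the eigenbasis \<open>T\<close>. This is what identifies, below, the eigenvalues
  that remain when the lowest eigenvectors are taken away.\<close>

lemma eigenvalue_list:
  fixes H :: "complex^'n^'n"
  assumes H: "hermitian H"
  obtains L where "sorted L" "length L = CARD('n)" "\<And>i. nth_eigenvalue i H = L ! (i - 1)"
    "\<And>T \<mu>. orthonormal T \<Longrightarrow> card T = CARD('n) \<Longrightarrow> (\<forall>u\<in>T. H *v u = complex_of_real (\<mu> u) *s u) \<Longrightarrow>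
      mset L = image_mset \<mu> (mset_set T)"
proof -
  let ?L = "sorted_list_of_multiset (image_mset Re (proots (charpoly H)))"
  have eq: "mset ?L = image_mset \<mu> (mset_set T)"
    if "orthonormal T" "card T = CARD('n)" "\<forall>u\<in>T. H *v u = complex_of_real (\<mu> u) *s u" for T \<mu>
    using charpoly_roots_eigenbasis[OF that(1,2)] that(3) by simp
  have "orthonormal ({} :: (complex^'n) set)" by (simp add: orthonormal_def)
  then obtain T where T: "orthonormal T" "card T = CARD('n)" "\<forall>u\<in>T. \<exists>\<mu>. H *v u = complex_of_real \<mu> *s u"
    using extend_orthonormal_eigenvectors[OF H, of "{}"] by (metis empty_iff)
  then obtain \<mu> where "\<forall>u\<in>T. H *v u = complex_of_real (\<mu> u) *s u" by metis
  then have "size (mset ?L) = size (image_mset \<mu> (mset_set T))" by (simp only: eq[OF T(1,2)])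
  then have len: "length ?L = CARD('n)" using T(2) unfolding size_mset by simp
  show ?thesis
  proof (rule that)
    show "sorted ?L" by simp
    show "nth_eigenvalue i H = ?L ! (i - 1)" for i by (simp add: nth_eigenvalue_def)
  qed (fact len, rule eq)
qed

lemma nth_eigenvalue_mono:
  fixes H :: "complex^'n^'n"
  assumes "hermitian H" "1 \<le> i" "i \<le> j" "j \<le> CARD('n)"
  shows "nth_eigenvalue i H \<le> nth_eigenvalue j H"
proof -
  obtain L where "sorted L" "length L = CARD('n)" "\<And>i. nth_eigenvalue i H = L ! (i - 1)"
    using eigenvalue_list[OF assms(1)] by metis
  then show ?thesis using assms by (auto intro!: sorted_nth_mono)
qed

text \<open>Stated for the part \<open>S\<close> of an eigenbasis that \<open>x\<close> involves: the lowest eigenvectors for \<open>x\<close> in the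
  range of a spectral projector, the others for \<open>x\<close> in its kernel.\<close>

lemma expansion_form:
  assumes x: "x = (\<Sum>u\<in>S. cdot u x *s u)" and eig: "\<And>u. u \<in> S \<Longrightarrow> H *v u = complex_of_real (\<mu> u) *s u"
  shows "x \<bullet> (H *v x) = (\<Sum>u\<in>S. \<mu> u * (norm (cdot u x))^2)"
proof -
  have "H *v x = (\<Sum>u\<in>S. cdot u x *s (complex_of_real (\<mu> u) *s u))"
    by (subst x) (simp add: matrix_vector_sum matrix_vector_smult eig)
  then have "cdot x (H *v x) = (\<Sum>u\<in>S. cdot u x * (complex_of_real (\<mu> u) * cnj (cdot u x)))"
    by (simp only: cdot_sum_right cdot_scale_right cnj_cdot)
  moreover have "Re (c * (complex_of_real m * cnj c)) = m * (norm c)^2" for c m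
    by (simp add: cmod_power2 power2_eq_square[of "Re c"] power2_eq_square[of "Im c"] algebra_simps)
  ultimately show ?thesis by (simp add: inner_cdot)
qed

lemma expansion_norm:
  assumes x: "x = (\<Sum>u\<in>S. cdot u x *s u)"
  shows "(norm x)^2 = (\<Sum>u\<in>S. (norm (cdot u x))^2)"
  using expansion_form[OF x, of "mat 1" "\<lambda>_. 1"] by (simp add: power2_norm_eq_inner)

text \<open>An orthogonal projector is determined by its range, so it acts by the expansion in any orthonormal
  basis of the range.\<close>

lemma lowest_spectral_projector_frame:
  fixes H :: "complex^'n^'n"
  assumes "lowest_spectral_projector r H p"
  obtains u where "lowest_eigenvectors r H u" "inj_on u {1..r}" "orthonormal (u ` {1..r})"
    "\<And>x. p *v x = (\<Sum>v\<in>u ` {1..r}. cdot v x *s v)"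
proof -
  obtain u where u: "lowest_eigenvectors r H u" and p: "orthogonal_projector p"
    and range: "range (\<lambda>x. p *v x) = vec.span (u ` {1..r})"
    using assms by (auto simp: lowest_spectral_projector_def orthogonal_projector_onto_def)
  let ?S = "u ` {1..r}"
  have inj: "inj_on u {1..r}"
    using u unfolding lowest_eigenvectors_def inj_on_def by (metis zero_neq_one)
  then have on: "orthonormal ?S"
    using u by (auto simp: lowest_eigenvectors_def orthonormal_def inj_on_eq_iff)
  have "p *v x = (\<Sum>v\<in>?S. cdot v x *s v)" for x
  proof -
    have fix_pt: "p *v v = v" if "v \<in> ?S" for v
    proof -
      have "v \<in> range (\<lambda>x. p *v x)" unfolding range using that by (rule vec.span_base)
      then show ?thesis using p by (auto simp: orthogonal_projector_def matrix_vector_mul_assoc)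
    qed
    have "p *v x = (\<Sum>v\<in>?S. cdot v (p *v x) *s v)"
      by (rule orthonormal_expansion_span[OF on]) (use range in blast)
    also have "\<dots> = (\<Sum>v\<in>?S. cdot v x *s v)"
    proof (intro sum.cong refl)
      fix v assume "v \<in> ?S"
      then show "cdot v (p *v x) *s v = cdot v x *s v"
        using cdot_hermitian[of p v x] p fix_pt by (simp add: orthogonal_projector_def)
    qed
    finally show ?thesis .
  qed
  with u inj on show ?thesis by (rule that)
qed

text \<open>The given eigenvectors for the lowest \<open>r\<close> eigenvalues extend to an eigenbasis. Its full list of
  eigenvalues is \<open>L\<close>, the given ones account for \<open>take r L\<close>, so the remaining ones form \<open>drop r L\<close> and are
  at least the \<open>(r + 1)\<close>-st eigenvalue. The \<open>r\<close>-th and the next eigenvalue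
  may coincide, as they may along the iteration.\<close>

lemma lowest_spectral_projector_bounds:
  fixes H :: "complex^'n^'n"
  assumes H: "hermitian H" and p: "lowest_spectral_projector r H p" and r: "1 \<le> r" "r < CARD('n)"
  shows "p *v x = x \<Longrightarrow> x \<bullet> (H *v x) \<le> nth_eigenvalue r H * (norm x)^2"
    and "p *v x = 0 \<Longrightarrow> nth_eigenvalue (r + 1) H * (norm x)^2 \<le> x \<bullet> (H *v x)"
proof -
  obtain u where u: "lowest_eigenvectors r H u" and inj: "inj_on u {1..r}"
    and on: "orthonormal (u ` {1..r})" and act: "\<And>x. p *v x = (\<Sum>v\<in>u ` {1..r}. cdot v x *s v)"
    using lowest_spectral_projector_frame[OF p] by blast
  let ?S = "u ` {1..r}"
  have Su: "H *v u i = complex_of_real (nth_eigenvalue i H) *s u i" if "i \<in> {1..r}" for i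
    using u that by (auto simp: lowest_eigenvectors_def)
  then have "\<forall>v\<in>?S. \<exists>\<mu>. H *v v = complex_of_real \<mu> *s v" by blast
  then obtain T where T: "?S \<subseteq> T" "orthonormal T" "card T = CARD('n)"
    "\<forall>v\<in>T. \<exists>\<mu>. H *v v = complex_of_real \<mu> *s v" and expT: "\<And>x. x = (\<Sum>u\<in>T. cdot u x *s u)"
    using extend_orthonormal_eigenvectors[OF H on] by blast
  from T(4) obtain \<mu> where \<mu>: "\<And>v. v \<in> T \<Longrightarrow> H *v v = complex_of_real (\<mu> v) *s v" by metis
  have fT: "finite T" using orthonormal_finite T by blast
  have \<mu>u: "\<mu> (u i) = nth_eigenvalue i H" if "i \<in> {1..r}" for i
  proof -
    have "u i \<in> T" using T that by blast
    then have "complex_of_real (\<mu> (u i)) *s u i = complex_of_real (nth_eigenvalue i H) *s u i"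
      using \<mu>[of "u i"] Su[OF that] by metis
    then have "cdot (u i) (complex_of_real (\<mu> (u i)) *s u i) = cdot (u i) (complex_of_real (nth_eigenvalue i H) *s u i)"
      by (rule arg_cong)
    moreover have "cdot (u i) (u i) = 1" using T(2) \<open>u i \<in> T\<close> by (simp add: orthonormal_def)
    ultimately show ?thesis by (simp add: cdot_scale_right)
  qed
  obtain L where L: "sorted L" "length L = CARD('n)" "\<And>i. nth_eigenvalue i H = L ! (i - 1)"
    and "\<And>T \<mu>. orthonormal T \<Longrightarrow> card T = CARD('n) \<Longrightarrow> (\<forall>u\<in>T. H *v u = complex_of_real (\<mu> u) *s u) \<Longrightarrow>
      mset L = image_mset \<mu> (mset_set T)"
    by (rule eigenvalue_list[OF H]) blast
  then have msetL: "mset L = image_mset \<mu> (mset_set T)" using T(2,3) \<mu> by blast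
  \<comment> \<open>Lists count from \<open>0\<close> and eigenvalues from \<open>1\<close>, hence the reindexing by \<open>Suc\<close>.\<close>
  have "image_mset \<mu> (mset_set ?S) = mset (take r L)"
  proof -
    have "{1..r} = Suc ` {0..<r}" by (simp add: image_Suc_atLeastLessThan atLeastLessThanSuc_atLeastAtMost)
    then have "mset_set {1..r} = image_mset Suc (mset_set {0..<r})" by (simp add: image_mset_mset_set)
    moreover have "image_mset \<mu> (mset_set ?S) = image_mset (\<lambda>i. \<mu> (u i)) (mset_set {1..r})"
      unfolding image_mset_mset_set[OF inj, symmetric] by (simp add: image_mset.compositionality o_def)
    ultimately have "image_mset \<mu> (mset_set ?S) = image_mset (\<lambda>i. \<mu> (u (Suc i))) (mset_set {0..<r})"
      by (simp add: image_mset.compositionality o_def)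
    also have "\<dots> = image_mset (\<lambda>i. L ! i) (mset_set {0..<r})"
      by (intro image_mset_cong) (simp add: \<mu>u L(3))
    also have "\<dots> = mset (map (\<lambda>i. L ! i) [0..<r])" by simp
    also have "map (\<lambda>i. L ! i) [0..<r] = take r L"
      using r L(2) by (intro nth_equalityI) auto
    finally show ?thesis .
  qed
  moreover have "mset_set T = mset_set ?S + mset_set (T - ?S)"
    using mset_set_Union[of ?S "T - ?S"] fT T(1) by (metis Diff_disjoint Un_Diff_cancel finite_Diff finite_subset sup.absorb2)
  moreover have "mset L = mset (take r L) + mset (drop r L)"
    by (metis append_take_drop_id mset_append)
  ultimately have rest: "image_mset \<mu> (mset_set (T - ?S)) = mset (drop r L)"
    using msetL by simp
  have high: "nth_eigenvalue (r + 1) H \<le> \<mu> v" if "v \<in> T - ?S" for v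
  proof -
    have "\<mu> v \<in># image_mset \<mu> (mset_set (T - ?S))" using that fT by simp
    then have "\<mu> v \<in> set (drop r L)" unfolding rest by simp
    then obtain k where "k < length (drop r L)" "\<mu> v = drop r L ! k" by (metis in_set_conv_nth)
    then show ?thesis using L by (auto intro!: sorted_nth_mono)
  qed
  have low: "\<mu> v \<le> nth_eigenvalue r H" if v: "v \<in> ?S" for v
    using v \<mu>u nth_eigenvalue_mono[OF H] r by auto
  show "x \<bullet> (H *v x) \<le> nth_eigenvalue r H * (norm x)^2" if "p *v x = x"
  proof -
    have x: "x = (\<Sum>v\<in>?S. cdot v x *s v)" using act[of x] that by simp
    have "x \<bullet> (H *v x) = (\<Sum>v\<in>?S. \<mu> v * (norm (cdot v x))^2)"
      by (rule expansion_form[OF x]) (use \<mu> T in blast)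
    also have "\<dots> \<le> (\<Sum>v\<in>?S. nth_eigenvalue r H * (norm (cdot v x))^2)"
      by (intro sum_mono mult_right_mono low) auto
    finally show ?thesis by (simp add: expansion_norm[OF x] sum_distrib_left)
  qed
  show "nth_eigenvalue (r + 1) H * (norm x)^2 \<le> x \<bullet> (H *v x)" if "p *v x = 0"
  proof -
    have zero: "cdot v x = 0" if v: "v \<in> ?S" for v
    proof -
      have "cdot v (p *v x) = (\<Sum>w\<in>?S. if w = v then cdot v x else 0)"
        unfolding act cdot_sum_right cdot_scale_right
        using on v by (intro sum.cong) (auto simp: orthonormal_def)
      also have "\<dots> = cdot v x" using v by simp
      finally show ?thesis using \<open>p *v x = 0\<close> by simp
    qed
    have "x = (\<Sum>v\<in>T. cdot v x *s v)" by (rule expT)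
    also have "\<dots> = (\<Sum>v\<in>T - ?S. cdot v x *s v)"
      using fT zero by (intro sum.mono_neutral_right) auto
    finally have x: "x = (\<Sum>v\<in>T - ?S. cdot v x *s v)" .
    have "nth_eigenvalue (r + 1) H * (norm x)^2 = (\<Sum>v\<in>T - ?S. nth_eigenvalue (r + 1) H * (norm (cdot v x))^2)"
      by (simp add: expansion_norm[OF x] sum_distrib_left)
    also have "\<dots> \<le> (\<Sum>v\<in>T - ?S. \<mu> v * (norm (cdot v x))^2)"
      by (intro sum_mono mult_right_mono high) auto
    also have "\<dots> = x \<bullet> (H *v x)"
      by (rule expansion_form[OF x, symmetric]) (use \<mu> in blast)
    finally show ?thesis .
  qed
qed

lemma lowest_spectral_projector_commutes:
  fixes H :: "complex^'n^'n"
  assumes H: "hermitian H" and p: "lowest_spectral_projector r H p"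
  shows "H ** p = p ** H"
proof -
  obtain u where u: "lowest_eigenvectors r H u" and act: "\<And>x. p *v x = (\<Sum>v\<in>u ` {1..r}. cdot v x *s v)"
    using lowest_spectral_projector_frame[OF p] by blast
  have "(H ** p) *v x = (p ** H) *v x" for x
  proof -
    have "(H ** p) *v x = (\<Sum>v\<in>u ` {1..r}. cdot v x *s (H *v v))"
      by (simp add: act matrix_vector_sum matrix_vector_smult flip: matrix_vector_mul_assoc)
    also have "\<dots> = (\<Sum>v\<in>u ` {1..r}. cdot v (H *v x) *s v)"
    proof (intro sum.cong refl)
      fix v assume "v \<in> u ` {1..r}"
      then obtain \<mu> where \<mu>: "H *v v = complex_of_real \<mu> *s v"
        using u by (auto simp: lowest_eigenvectors_def)
      have "cdot v (H *v x) = cdot (complex_of_real \<mu> *s v) x"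
        using cdot_hermitian[OF H, of v x] \<mu> by simp
      also have "\<dots> = complex_of_real \<mu> * cdot v x"
        by (simp add: cdot_def sum_distrib_left mult_ac)
      finally show "cdot v x *s (H *v v) = cdot v (H *v x) *s v"
        by (simp add: \<mu> mult.commute)
    qed
    also have "\<dots> = (p ** H) *v x" by (simp add: act flip: matrix_vector_mul_assoc)
    finally show ?thesis .
  qed
  then show ?thesis by (simp add: matrix_eq)
qed

lemma lowest_block_spectral:
  fixes H :: "complex^'n^'n"
  assumes H: "hermitian H" and p: "lowest_spectral_projector r H p" and r: "1 \<le> r" "r < CARD('n)"
  shows "lowest_block H p (nth_eigenvalue r H) (nth_eigenvalue (r + 1) H)"
  unfolding lowest_block_def
proof (intro conjI allI impI)
  show "orthogonal_projector p"
    using p by (auto simp: lowest_spectral_projector_def orthogonal_projector_onto_def)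
  show "H ** p = p ** H" by (rule lowest_spectral_projector_commutes[OF H p])
next
  fix X :: "complex^'n^'n" assume X: "p ** X = X"
  have "X \<bullet> (H ** X) = (\<Sum>j\<in>UNIV. column j X \<bullet> (H *v column j X))"
    by (simp add: inner_by_columns column_mult)
  also have "\<dots> \<le> (\<Sum>j\<in>UNIV. nth_eigenvalue r H * (norm (column j X))^2)"
    by (intro sum_mono lowest_spectral_projector_bounds[OF H p r]) (simp add: X flip: column_mult)
  finally show "X \<bullet> (H ** X) \<le> nth_eigenvalue r H * (norm X)^2"
    by (simp add: norm_by_columns sum_distrib_left)
next
  fix X :: "complex^'n^'n" assume X: "p ** X = 0"
  have "nth_eigenvalue (r + 1) H * (norm X)^2 = (\<Sum>j\<in>UNIV. nth_eigenvalue (r + 1) H * (norm (column j X))^2)"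
    by (simp add: norm_by_columns sum_distrib_left)
  also have "\<dots> \<le> (\<Sum>j\<in>UNIV. column j X \<bullet> (H *v column j X))"
    by (intro sum_mono lowest_spectral_projector_bounds[OF H p r])
      (simp add: X flip: column_mult, simp add: column_def vec_eq_iff)
  also have "\<dots> = X \<bullet> (H ** X)" by (simp add: inner_by_columns column_mult)
  finally show "nth_eigenvalue (r + 1) H * (norm X)^2 \<le> X \<bullet> (H ** X)" .
qed

lemma outer_mult_vec: "outer u *v x = cdot u x *s u"
  by (simp add: outer_def matrix_vector_mult_def cdot_def vec_eq_iff sum_distrib_left mult_ac)

lemma sum_outer_mult_vec: "(\<Sum>u\<in>S. outer u) *v x = (\<Sum>u\<in>S. cdot u x *s u)"
  by (induction S rule: infinite_finite_induct) (simp_all add: outer_mult_vec matrix_vector_mult_add_rdistrib)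

lemma lowest_spectral_projector_norm:
  fixes H :: "complex^'n^'n"
  assumes p: "lowest_spectral_projector r H p"
  shows "norm p = sqrt (real r)"
proof -
  obtain u where inj: "inj_on u {1..r}" and on: "orthonormal (u ` {1..r})"
    and act: "\<And>x. p *v x = (\<Sum>v\<in>u ` {1..r}. cdot v x *s v)"
    using lowest_spectral_projector_frame[OF p] by blast
  have op: "orthogonal_projector p"
    using p by (auto simp: lowest_spectral_projector_def orthogonal_projector_onto_def)
  have p_eq: "p = (\<Sum>v\<in>u ` {1..r}. outer v)"
    by (simp add: matrix_eq act sum_outer_mult_vec)
  have "outer v \<bullet> mat 1 = v \<bullet> v" for v :: "complex^'n"
  proof -
    have "outer v \<bullet> mat 1 = (\<Sum>i\<in>UNIV. \<Sum>j\<in>UNIV. if i = j then v $ i \<bullet> v $ i else 0)"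
      unfolding inner_matrix_sum
      by (intro sum.cong refl) (auto simp: outer_def mat_def inner_complex_def)
    then show ?thesis by (simp add: inner_vec_def)
  qed
  moreover have "v \<bullet> v = 1" if "v \<in> u ` {1..r}" for v
    using bspec[OF bspec[OF on[unfolded orthonormal_def] that] that] by (simp add: inner_cdot)
  ultimately have "p \<bullet> mat 1 = (\<Sum>v\<in>u ` {1..r}. 1)"
    by (simp add: p_eq inner_sum_left)
  also have "\<dots> = real r" using inj by (simp add: card_image)
  finally have "p \<bullet> mat 1 = real r" .
  moreover have "p \<bullet> p = p \<bullet> mat 1"
    using op inner_hermitian[of p p "mat 1"] by (simp add: orthogonal_projector_def)
  ultimately show ?thesis by (simp add: norm_eq_sqrt_inner)
qed

lemma conj_vector_cdot: "cdot (\<chi> i. cnj (u $ i)) (\<chi> i. cnj (v $ i)) = cdot v u"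
  by (simp add: cdot_def mult.commute)

text \<open>The rank is the dimension of the row space, and the rows of \<open>p\<close> span the complex conjugates of the
  vectors \<open>u i\<close>.\<close>

lemma sum_outer_lowest_projector:
  fixes H :: "complex^'n^'n"
  assumes u: "lowest_eigenvectors r H u"
  defines "p \<equiv> (\<Sum>i=1..r. outer (u i))"
  shows "lowest_spectral_projector r H p" "p \<in> rank_projectors r"
proof -
  let ?S = "u ` {1..r}"
  have inj: "inj_on u {1..r}"
    using u unfolding lowest_eigenvectors_def inj_on_def by (metis zero_neq_one)
  have on: "orthonormal ?S"
    using u inj by (auto simp: lowest_eigenvectors_def orthonormal_def inj_on_eq_iff)
  have p: "p = (\<Sum>v\<in>?S. outer v)" unfolding p_def sum.reindex[OF inj] by simp
  have act: "p *v x = (\<Sum>v\<in>?S. cdot v x *s v)" for x by (simp add: p sum_outer_mult_vec)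
  have conj_outer: "conj_transpose (\<Sum>v\<in>A. outer v) = (\<Sum>v\<in>A. outer v)" for A :: "(complex^'n) set"
    by (induction A rule: infinite_finite_induct)
      (simp_all add: conj_transpose_add, simp_all add: conj_transpose_def outer_def vec_eq_iff mult.commute)
  have in_span: "p *v x \<in> vec.span ?S" for x
    unfolding act by (intro vec.span_sum vec.span_scale vec.span_base)
  have fix_span: "p *v x = x" if "x \<in> vec.span ?S" for x
    using orthonormal_expansion_span[OF on that] act by simp
  have "(p ** p) *v x = p *v x" for x
    using fix_span[OF in_span] by (simp flip: matrix_vector_mul_assoc)
  then have op: "orthogonal_projector p"
    using conj_outer[of ?S] by (simp add: orthogonal_projector_def hermitian_def matrix_eq p)
  have "range (\<lambda>x. p *v x) = vec.span ?S"
    using in_span fix_span by (metis (no_types, lifting) image_subset_iff rangeI subsetI subset_antisym)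
  then show "lowest_spectral_projector r H p"
    using u op by (auto simp: lowest_spectral_projector_def orthogonal_projector_onto_def)
  let ?c = "\<lambda>v::complex^'n. (\<chi> i. cnj (v $ i)) :: complex^'n"
  let ?C = "?c ` ?S"
  have injc: "inj_on ?c ?S" by (auto simp: inj_on_def vec_eq_iff)
  have onC: "orthonormal ?C"
    using on by (auto simp: orthonormal_def conj_vector_cdot vec_eq_iff)
  have tr: "transpose p = (\<Sum>v\<in>?C. outer v)"
  proof -
    have "transpose (\<Sum>v\<in>A. outer v) = (\<Sum>v\<in>A. outer (?c v))" for A :: "(complex^'n) set"
    proof (induction A rule: infinite_finite_induct)
      case (insert v A)
      have "transpose (outer v + (\<Sum>v\<in>A. outer v)) = transpose (outer v) + transpose (\<Sum>v\<in>A. outer v)"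
        by (simp add: transpose_def vec_eq_iff)
      then show ?case using insert by (simp add: transpose_def outer_def vec_eq_iff mult.commute)
    qed (simp_all add: transpose_def vec_eq_iff)
    then show ?thesis by (simp only: p sum.reindex[OF injc] o_def)
  qed
  have actC: "transpose p *v x = (\<Sum>v\<in>?C. cdot v x *s v)" for x by (simp add: tr sum_outer_mult_vec)
  have "vec.span (rows p) = vec.span ?C"
  proof (rule vec.span_eq[THEN iffD2], intro conjI subsetI)
    fix x assume "x \<in> rows p"
    then obtain i where "x = column i (transpose p)" by (auto simp: rows_def column_transpose)
    also have "\<dots> = transpose p *v axis i 1"
      unfolding column_def by (simp add: vec_eq_iff matrix_vector_mult_def axis_def if_distrib cong: if_cong)
    also have "\<dots> \<in> vec.span ?C"
      unfolding actC by (intro vec.span_sum vec.span_scale vec.span_base)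
    finally show "x \<in> vec.span ?C" .
  next
    fix x assume x: "x \<in> ?C"
    then have "x = (\<Sum>v\<in>?C. cdot v x *s v)"
      by (intro orthonormal_expansion_span[OF onC] vec.span_base)
    then have "x = transpose p *v x" unfolding actC .
    also have "\<dots> \<in> vec.span (columns (transpose p))" by (rule matrix_vector_mult_in_columnspace_gen)
    finally show "x \<in> vec.span (rows p)" by (simp add: columns_transpose)
  qed
  then have "vec.dim (rows p) = vec.dim ?C" by (metis vec.dim_span)
  also have "\<dots> = card ?C" by (rule vec.dim_eq_card_independent[OF orthonormal_independent[OF onC]])
  also have "\<dots> = r" using injc inj by (simp add: card_image)
  finally show "p \<in> rank_projectors r" using op by (simp add: rank_projectors_def row_rank_def_gen)
qed

section \<open>Excess energy of a perturbed block\<close>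

text \<open>The local setting: \<open>p\<close> is the spectral projector under study, \<open>P\<close> a larger one, \<open>a\<close> and \<open>c\<close> are the
  levels of \<open>H\<close> on either side of the gap of \<open>p\<close>, and \<open>l\<close> is a lower bound for \<open>H\<close> outside the
  range of \<open>P\<close>. It is used for \<open>p = P\<^sub>m\<close> and also for \<open>p = P\<close>, where \<open>c = l\<close>.\<close>

locale two_level =
  fixes H p P :: "complex^'N^'N" and a c l b :: real
  assumes H: "hermitian H"
    and low: "lowest_block H p a c"
    and P: "orthogonal_projector P" and HP: "H ** P = P ** H" and Pp: "P ** p = p"
    and high: "\<And>X::complex^'N^'N. P ** X = 0 \<Longrightarrow> l * (norm X)^2 \<le> X \<bullet> (H ** X)"
    and ac: "a < c" and al: "a < l" and b: "0 < b"
begin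

text \<open>The factor \<open>b / (b + \<Delta>)\<close> for the distance \<open>\<Delta> = l - a\<close> between the levels.\<close>

definition \<gamma> :: real where "\<gamma> = b / (b + (l - a))"

text \<open>On the block of matrices \<open>X\<close> with \<open>p ** X = 0\<close> and \<open>X ** p = X\<close> this is the Sylvester operator of \<open>H\<close>,
  with spectrum consisting of the differences of an eigenvalue off the range of \<open>p\<close> and one on it.\<close>

definition \<G> :: "complex^'N^'N \<Rightarrow> complex^'N^'N" where "\<G> X = H ** X - X ** H"

definition off_diagonal :: "complex^'N^'N \<Rightarrow> bool" where
  "off_diagonal X \<longleftrightarrow> p ** X = 0 \<and> X ** p = X"

text \<open>The properties of the compression error \<open>E\<close> for the projector \<open>Q\<close> that the analysis uses. The
  inequality says \<open>E\<^sup>2 \<le> b E\<close>, that is \<open>0 \<le> E \<le> b\<close>.\<close>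

definition admissible :: "complex^'N^'N \<Rightarrow> complex^'N^'N \<Rightarrow> bool" where
  "admissible E Q \<longleftrightarrow> hermitian E \<and> hermitian Q \<and> E ** Q = 0 \<and>
     (\<forall>X::complex^'N^'N. (norm (E ** X))^2 \<le> b * (X \<bullet> (E ** X)))"

text \<open>\<open>F\<close> projects along the kernel of \<open>p\<close> onto an \<open>(H + E)\<close>-invariant subspace, which is the graph
  of \<open>F - p\<close> over the range of \<open>p\<close>. The norm bound makes the constants below uniform.\<close>

definition graph_projector :: "complex^'N^'N \<Rightarrow> complex^'N^'N \<Rightarrow> bool" where
  "graph_projector E F \<longleftrightarrow> p ** F = p \<and> F ** p = F \<and> norm F \<le> 2 * norm p \<and>
     (H + E) ** F = F ** ((H + E) ** F)"

text \<open>This is \<open>Re (tr (p ** E ** F))\<close>. As \<open>p ** H ** F = H ** p\<close>, it is the trace of \<open>H + E\<close> on the range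
  of \<open>F\<close> minus the trace of \<open>H\<close> on the range of \<open>p\<close>.\<close>

definition energy :: "complex^'N^'N \<Rightarrow> complex^'N^'N \<Rightarrow> real" where
  "energy E F = p \<bullet> (E ** F)"

lemma p: "orthogonal_projector p" and Hp: "H ** p = p ** H"
  and up: "\<And>X::complex^'N^'N. p ** X = X \<Longrightarrow> X \<bullet> (H ** X) \<le> a * (norm X)^2"
  and lo: "\<And>X::complex^'N^'N. p ** X = 0 \<Longrightarrow> c * (norm X)^2 \<le> X \<bullet> (H ** X)"
  using low by (auto simp: lowest_block_def)

lemmas p_simps = orthogonal_projectorD[OF p]
lemmas P_simps = orthogonal_projectorD[OF P]

lemma pP: "p ** P = p"
  by (metis P_simps(4) Pp conj_transpose_mult p_simps(4))

lemma gamma: "0 < \<gamma>" "\<gamma> < 1"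
  using al b by (auto simp: \<gamma>_def field_simps)

text \<open>Passing to the conjugate transpose, the columns of which lie in the range of \<open>p\<close>.\<close>

lemma right_multiplication_le:
  fixes X :: "complex^'N^'N"
  assumes "X ** p = X"
  shows "X \<bullet> (X ** H) \<le> a * (norm X)^2"
proof -
  let ?Y = "conj_transpose X"
  have "p ** ?Y = ?Y" using assms by (metis conj_transpose_mult p_simps(4))
  then have "?Y \<bullet> (H ** ?Y) \<le> a * (norm ?Y)^2" by (rule up)
  moreover have "?Y \<bullet> (H ** ?Y) = X \<bullet> (X ** H)"
    using inner_conj_transpose[of X "X ** H"] H by (simp add: conj_transpose_mult hermitian_def)
  ultimately show ?thesis by simp
qed

lemma G_lower: "off_diagonal X \<Longrightarrow> (c - a) * (norm X)^2 \<le> X \<bullet> \<G> X"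
  using lo[of X] right_multiplication_le[of X]
  by (simp add: off_diagonal_def \<G>_def inner_diff_right left_diff_distrib)

lemma G_lower_high: "P ** X = 0 \<Longrightarrow> X ** p = X \<Longrightarrow> (l - a) * (norm X)^2 \<le> X \<bullet> \<G> X"
  using high[of X] right_multiplication_le[of X]
  by (simp add: \<G>_def inner_diff_right left_diff_distrib)

lemma G_symmetric: "X \<bullet> \<G> Y = Y \<bullet> \<G> X"
  unfolding \<G>_def inner_diff_right
  by (metis H inner_commute inner_hermitian inner_hermitian_right)

lemma G_add: "\<G> (X + Y) = \<G> X + \<G> Y"
  by (simp add: \<G>_def matrix_distribs)

lemma G_scaleR: "\<G> (t *\<^sub>R X) = t *\<^sub>R \<G> X"
  by (simp add: \<G>_def matrix_scaleR_left matrix_scaleR_right scaleR_right_diff_distrib)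

lemma off_diagonal_add: "off_diagonal X \<Longrightarrow> off_diagonal Y \<Longrightarrow> off_diagonal (X + Y)"
  by (simp add: off_diagonal_def matrix_distribs)

lemma off_diagonal_scaleR: "off_diagonal X \<Longrightarrow> off_diagonal (t *\<^sub>R X)"
  by (simp add: off_diagonal_def matrix_scaleR_left matrix_scaleR_right)

lemma G_nonneg: "off_diagonal X \<Longrightarrow> 0 \<le> X \<bullet> \<G> X"
  by (rule order_trans[OF _ G_lower]) (use ac in auto)

lemma G_cauchy_schwarz:
  assumes "off_diagonal X" "off_diagonal Y"
  shows "X \<bullet> \<G> Y \<le> sqrt (X \<bullet> \<G> X) * sqrt (Y \<bullet> \<G> Y)"
proof -
  have "(X \<bullet> \<G> Y)^2 \<le> (X \<bullet> \<G> X) * (Y \<bullet> \<G> Y)"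
  proof (rule quadratic_nonneg_discriminant)
    fix t :: real
    have "0 \<le> (X + t *\<^sub>R Y) \<bullet> \<G> (X + t *\<^sub>R Y)"
      by (intro G_nonneg off_diagonal_add off_diagonal_scaleR assms)
    also have "\<dots> = X \<bullet> \<G> X + 2 * t * (X \<bullet> \<G> Y) + t^2 * (Y \<bullet> \<G> Y)"
      by (simp add: G_add G_scaleR inner_add_left inner_add_right G_symmetric[of Y X]
          power2_eq_square algebra_simps)
    finally show "0 \<le> X \<bullet> \<G> X + 2 * t * (X \<bullet> \<G> Y) + t\<^sup>2 * (Y \<bullet> \<G> Y)" .
  qed (intro G_nonneg assms)
  then have "X \<bullet> \<G> Y \<le> sqrt ((X \<bullet> \<G> X) * (Y \<bullet> \<G> Y))" by (rule real_le_rsqrt)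
  then show ?thesis by (simp add: real_sqrt_mult)
qed

lemma admissible_norm:
  assumes "admissible E Q"
  shows "norm (E ** X) \<le> b * norm (X::complex^'N^'N)" "0 \<le> X \<bullet> (E ** X)"
proof -
  have *: "(norm (E ** X))^2 \<le> b * (X \<bullet> (E ** X))"
    using assms by (simp add: admissible_def)
  have "0 \<le> (norm (E ** X))^2" by simp
  with * have "0 \<le> b * (X \<bullet> (E ** X))" by linarith
  then show "0 \<le> X \<bullet> (E ** X)" using b by (simp add: zero_le_mult_iff)
  have "norm (E ** X) * norm (E ** X) \<le> (b * norm X) * norm (E ** X)"
    using * norm_cauchy_schwarz[of X "E ** X"] b
    by (metis (no_types, lifting) less_imp_le mult.assoc mult_left_mono order_trans power2_eq_square)
  then show "norm (E ** X) \<le> b * norm X"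
    using b by (cases "norm (E ** X) = 0") (auto simp: mult_le_cancel_right)
qed

lemma admissible_range:
  assumes "admissible E Q"
  shows "P ** E = (P - Q) ** E"
proof -
  have "Q ** E = conj_transpose (E ** Q)"
    using assms unfolding conj_transpose_mult by (simp add: admissible_def hermitian_def)
  also have "\<dots> = 0" using assms by (simp add: admissible_def conj_transpose_def vec_eq_iff)
  finally show ?thesis by (simp add: matrix_distribs)
qed

text \<open>\<open>E\<close> kills the range of \<open>Q\<close> and the range of \<open>p\<close> lies in that of \<open>P\<close>, so \<open>E\<close> sees only
  \<open>P - Q\<close> there.\<close>

lemma admissible_small:
  assumes "admissible E Q"
  shows "norm (E ** p) \<le> b * norm (P - Q) * norm p" "norm (p ** E) \<le> b * norm (P - Q) * norm p"
proof -
  have "E ** p = E ** ((P - Q) ** p) + E ** Q ** p"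
    by (simp add: matrix_distribs Pp matrix_mul_assoc)
  then have "E ** p = E ** ((P - Q) ** p)" using assms by (simp add: admissible_def)
  then have "norm (E ** p) \<le> b * norm ((P - Q) ** p)" using admissible_norm(1)[OF assms] by simp
  also have "\<dots> \<le> b * (norm (P - Q) * norm p)"
    using b by (intro mult_left_mono norm_matrix_mult) simp
  finally show 1: "norm (E ** p) \<le> b * norm (P - Q) * norm p" by (simp add: mult.assoc)
  have "p ** E = conj_transpose (E ** p)"
    using assms p_simps(4) by (simp add: admissible_def hermitian_def conj_transpose_mult)
  then show "norm (p ** E) \<le> b * norm (P - Q) * norm p" using 1 by simp
qed

lemma graph_offset:
  assumes "graph_projector E F"
  shows "off_diagonal (F - p)"
  using assms p_simps(2) by (simp add: graph_projector_def off_diagonal_def matrix_distribs)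

text \<open>Since \<open>F ** p = F\<close> and \<open>p ** F = p\<close>, the term \<open>F ** H ** F\<close> of the invariance equation collapses to
  \<open>F ** H\<close>; only the perturbation stays quadratic in \<open>F\<close>.\<close>

lemma riccati:
  assumes F: "graph_projector E F"
  shows "E ** F = F ** (p ** E ** F) - \<G> (F - p)"
proof -
  have pF: "p ** F = p" and Fp: "F ** p = F" and inv: "(H + E) ** F = F ** ((H + E) ** F)"
    using F by (auto simp: graph_projector_def)
  have "F ** (H ** F) = F ** (p ** (H ** F))" by (metis Fp matrix_mul_assoc)
  also have "p ** (H ** F) = p ** H" by (metis Hp pF matrix_mul_assoc)
  also have "F ** (p ** H) = F ** H" by (metis Fp matrix_mul_assoc)
  finally have FHF: "F ** (H ** F) = F ** H" .
  have FEF: "F ** (E ** F) = F ** (p ** E ** F)" by (metis Fp matrix_mul_assoc)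
  have "H ** F + E ** F = F ** H + F ** (p ** E ** F)"
    using inv by (simp add: matrix_distribs FHF FEF)
  then show ?thesis by (simp add: \<G>_def matrix_distribs Hp algebra_simps)
qed

lemma coupling_small:
  assumes "admissible E Q" "graph_projector E F"
  shows "norm (p ** E ** F) \<le> 2 * b * (norm p)^2 * norm (P - Q)"
proof -
  have "norm (p ** E ** F) \<le> norm (p ** E) * norm F" by (rule norm_matrix_mult)
  also have "\<dots> \<le> (b * norm (P - Q) * norm p) * (2 * norm p)"
    using admissible_small[OF assms(1)] assms(2) b by (intro mult_mono) (auto simp: graph_projector_def)
  finally show ?thesis by (simp add: power2_eq_square mult_ac)
qed

lemma inner_p_off_diagonal:
  assumes "off_diagonal Y"
  shows "p \<bullet> (Y ** K) = 0" "Y \<bullet> (p ** K) = 0" "p \<bullet> \<G> Y = 0"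
proof -
  have pY: "p ** Y = 0" using assms by (simp add: off_diagonal_def)
  have 0: "Z \<bullet> (p ** K) = (p ** Z) \<bullet> K" for Z K :: "complex^'N^'N"
    by (rule inner_hermitian[OF p_simps(1), symmetric])
  show "Y \<bullet> (p ** K) = 0" by (simp add: 0 pY)
  have pp: "p \<bullet> Z = p \<bullet> (p ** Z)" for Z :: "complex^'N^'N" by (simp add: 0 p_simps(2))
  show "p \<bullet> (Y ** K) = 0" by (subst pp) (simp add: matrix_mul_assoc pY)
  have "p ** \<G> Y = 0" by (simp add: \<G>_def matrix_distribs matrix_mul_assoc pY Hp[symmetric])
      (simp add: pY flip: matrix_mul_assoc)
  then show "p \<bullet> \<G> Y = 0" by (subst pp) simp
qed

text \<open>The Riccati equation tested with \<open>F = p + Y\<close>; the mixed terms vanish because \<open>p\<close> and \<open>Y\<close> have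
  orthogonal ranges.\<close>

lemma energy_identity:
  assumes F: "graph_projector E F"
  defines "Y \<equiv> F - p"
  shows "energy E F + Y \<bullet> (Y ** (p ** E ** F)) = Y \<bullet> \<G> Y + F \<bullet> (E ** F)"
proof -
  let ?K = "p ** E ** F"
  have Y: "off_diagonal Y" unfolding Y_def by (rule graph_offset[OF F])
  have FY: "F = p + Y" by (simp add: Y_def)
  have e: "p \<bullet> (p ** ?K) = energy E F"
    using inner_hermitian[OF p_simps(1), of p "E ** F"] p_simps(2,3)
    by (simp add: energy_def matrix_mul_assoc)
  have "F \<bullet> (E ** F) = F \<bullet> (F ** ?K) - F \<bullet> \<G> Y"
    unfolding Y_def riccati[OF F] inner_diff_right
    by (simp add: riccati[OF F, symmetric] matrix_mul_assoc)
  also have "F \<bullet> (F ** ?K) = (p + Y) \<bullet> ((p + Y) ** ?K)" by (simp only: FY[symmetric])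
  also have "\<dots> = energy E F + Y \<bullet> (Y ** ?K)"
    by (simp only: matrix_plus_rdistrib inner_add_left inner_add_right inner_p_off_diagonal[OF Y] e)
  also have "F \<bullet> \<G> Y = Y \<bullet> \<G> Y"
    by (subst FY) (simp only: inner_add_left inner_p_off_diagonal[OF Y])
  finally show ?thesis by simp
qed

lemma coupling_error:
  assumes "admissible E Q" "graph_projector E F"
  shows "\<bar>Y \<bullet> (Z ** (p ** E ** F))\<bar> \<le> norm Y * norm Z * (2 * b * (norm p)^2 * norm (P - Q))"
proof -
  have "\<bar>Y \<bullet> (Z ** (p ** E ** F))\<bar> \<le> norm Y * norm (Z ** (p ** E ** F))"
    by (rule Cauchy_Schwarz_ineq2)
  also have "\<dots> \<le> norm Y * (norm Z * norm (p ** E ** F))"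
    by (intro mult_left_mono norm_matrix_mult) simp
  also have "\<dots> \<le> norm Y * (norm Z * (2 * b * (norm p)^2 * norm (P - Q)))"
    by (intro mult_left_mono coupling_small assms) simp_all
  finally show ?thesis by (simp add: mult.assoc)
qed

text \<open>Near \<open>P\<close> the term of \<open>energy_identity\<close> with \<open>Y ** K\<close>, for \<open>K = p ** E ** F\<close>, is absorbed by half of the gap, so the energy
  controls both the offset \<open>F - p\<close> and the energy of \<open>E\<close> on the range of \<open>F\<close>.\<close>

lemma offset_le_energy:
  assumes E: "admissible E Q" and F: "graph_projector E F"
    and small: "2 * b * (norm p)^2 * norm (P - Q) \<le> (c - a) / 2"
  shows "(c - a) / 2 * (norm (F - p))^2 + F \<bullet> (E ** F) \<le> energy E F"
proof -
  let ?Y = "F - p"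
  have "?Y \<bullet> (?Y ** (p ** E ** F)) \<le> norm ?Y * norm ?Y * (2 * b * (norm p)^2 * norm (P - Q))"
    using coupling_error[OF E F, of ?Y ?Y] by linarith
  also have "\<dots> \<le> norm ?Y * norm ?Y * ((c - a) / 2)"
    by (intro mult_left_mono small) simp
  also have "\<dots> = (c - a) * (norm ?Y)^2 - (c - a) / 2 * (norm ?Y)^2"
    by (simp add: power2_eq_square algebra_simps)
  finally show ?thesis
    using energy_identity[OF F] G_lower[OF graph_offset[OF F]] by linarith
qed

text \<open>The heart of the rate. Let \<open>Y = F - p\<close> split into \<open>X\<close>, with values in the range of \<open>P\<close>, and
  \<open>W\<close>, with values orthogonal to it. The Riccati equation splits accordingly. For \<open>X\<close> its right-hand
  side is of order \<open>d * sqrt e\<close>, so \<open>X \<bullet> \<G> X\<close> is of order \<open>d * e\<close>. For \<open>W\<close> it gives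
  \<open>(l - a) * (W \<bullet> \<G> W) \<le> (norm (\<G> W))\<^sup>2 \<le> (norm (E ** F))\<^sup>2 \<le> b * (F \<bullet> (E ** F))\<close>
  up to terms of order \<open>d * e\<close>, and inserting this into \<open>energy_identity\<close> produces \<open>\<gamma>\<close>.\<close>

lemma energy_estimate:
  obtains C \<epsilon> where "0 < C" "0 < \<epsilon>"
    "\<And>E Q F. \<lbrakk>admissible E Q; graph_projector E F; norm (P - Q) \<le> \<epsilon>\<rbrakk> \<Longrightarrow> (norm (F - p))^2 \<le> C * energy E F"
    "\<And>E Q F. \<lbrakk>admissible E Q; graph_projector E F; norm (P - Q) \<le> \<epsilon>\<rbrakk> \<Longrightarrow>
       (F - p) \<bullet> \<G> (F - p) \<le> \<gamma> * (1 + C * norm (P - Q)) * energy E F"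
proof -
  define k1 where "k1 = 2 * b * (norm p)^2"
  define C0 where "C0 = 2 / (c - a)"
  define c0 where "c0 = sqrt C0"
  define b0 where "b0 = sqrt b"
  define q where "q = norm (P - p)"
  define k3 where "k3 = q * c0 * (q * c0 * k1 + q * b0)"
  define k4 where "k4 = 2 * b0 * c0 * k1 + c0^2 * k1^2"
  define k5 where "k5 = k1 * C0 + k4 / b"
  define C where "C = C0 + k5 + k3 / \<gamma>"
  define \<epsilon> where "\<epsilon> = min 1 ((c - a) / (2 * (k1 + 1)))"
  have k1: "0 \<le> k1" using b by (simp add: k1_def)
  have C0: "0 < C0" using ac by (simp add: C0_def)
  have c0: "0 < c0" "c0^2 = C0" using C0 by (simp_all add: c0_def)
  have b0: "0 < b0" "b0^2 = b" using b by (simp_all add: b0_def)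
  have q: "0 \<le> q" by (simp add: q_def)
  have k3: "0 \<le> k3" using q c0 b0 k1 by (simp add: k3_def)
  have k4: "0 \<le> k4" unfolding k4_def using c0(1) b0(1) k1 by (intro add_nonneg_nonneg mult_nonneg_nonneg) auto
  have k5: "0 \<le> k5" using k1 C0 k4 b by (simp add: k5_def)
  have C: "0 < C" using C0 k5 k3 gamma by (simp add: C_def add_pos_nonneg)
  have \<epsilon>: "0 < \<epsilon>" using k1 ac by (simp add: \<epsilon>_def)
  have small: "k1 * d \<le> (c - a) / 2" if "d \<le> \<epsilon>" "0 \<le> d" for d
  proof -
    have "k1 * d \<le> (k1 + 1) * ((c - a) / (2 * (k1 + 1)))"
      using that k1 ac by (intro mult_mono) (auto simp: \<epsilon>_def)
    also have "\<dots> = (c - a) / 2" using k1 by (simp add: field_simps)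
    finally show ?thesis .
  qed
  have main: "(norm (F - p))^2 \<le> C0 * energy E F \<and>
       (F - p) \<bullet> \<G> (F - p) \<le> \<gamma> * (1 + (k5 + k3 / \<gamma>) * norm (P - Q)) * energy E F"
    if E: "admissible E Q" and F: "graph_projector E F" and d: "norm (P - Q) \<le> \<epsilon>" for E Q F
  proof -
    define d where "d = norm (P - Q)"
    define Y where "Y = F - p"
    define e where "e = energy E F"
    define \<phi> where "\<phi> = F \<bullet> (E ** F)"
    define K where "K = p ** E ** F"
    have d0: "0 \<le> d" "d \<le> 1" "k1 * d \<le> (c - a) / 2"
      using d small by (auto simp: d_def \<epsilon>_def)
    have base: "(c - a) / 2 * (norm Y)^2 + \<phi> \<le> e"
      using offset_le_energy[OF E F] d0(3) by (simp add: Y_def \<phi>_def e_def d_def k1_def)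
    have \<phi>0: "0 \<le> \<phi>" unfolding \<phi>_def by (rule admissible_norm[OF E])
    have e0: "0 \<le> e" using base \<phi>0 ac by (smt (verit) divide_nonneg_nonneg mult_nonneg_nonneg zero_le_power2)
    have \<phi>e: "\<phi> \<le> e" using base ac by (smt (verit) divide_nonneg_nonneg mult_nonneg_nonneg zero_le_power2)
    have Y2: "(norm Y)^2 \<le> C0 * e"
      using base \<phi>0 ac by (simp add: C0_def field_simps)
    define s where "s = sqrt e"
    have s: "0 \<le> s" "s * s = e" using e0 by (simp_all add: s_def)
    have nY: "norm Y \<le> c0 * s"
      using real_le_rsqrt[OF Y2] by (simp add: c0_def s_def real_sqrt_mult)
    have EF2: "(norm (E ** F))^2 \<le> b * \<phi>" using E by (simp add: admissible_def \<phi>_def)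
    also have "\<dots> \<le> b * e" using b \<phi>e by simp
    finally have nEF: "norm (E ** F) \<le> b0 * s"
      using real_le_rsqrt[of "norm (E ** F)" "b * e"] by (simp add: b0_def s_def real_sqrt_mult)
    have nK: "norm K \<le> k1 * d"
      unfolding K_def k1_def d_def by (rule coupling_small[OF E F])
    have Yod: "off_diagonal Y" unfolding Y_def by (rule graph_offset[OF F])
    have pY: "p ** Y = 0" and Yp: "Y ** p = Y" using Yod by (auto simp: off_diagonal_def)
    have GY: "\<G> Y = F ** K - E ** F" using riccati[OF F] by (simp add: Y_def K_def)
    have FY: "F = p + Y" by (simp add: Y_def)
    define D where "D = P - p"
    define X W where "X = D ** Y" and "W = Y - P ** Y"
    have XPY: "X = P ** Y" using pY by (simp add: X_def D_def matrix_distribs)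
    have YXW: "Y = X + W" by (simp add: XPY W_def)
    have Xp: "X ** p = X" and Wp: "W ** p = W"
      using Yp by (simp_all add: X_def W_def matrix_distribs flip: matrix_mul_assoc)
    have pX: "p ** X = 0" using pY pP by (simp add: XPY matrix_mul_assoc)
    have PW: "P ** W = 0" by (simp add: W_def matrix_distribs P_simps)
    have Xod: "off_diagonal X" using pX Xp by (simp add: off_diagonal_def)
    have DH: "D ** H = H ** D" by (simp add: D_def matrix_distribs HP Hp)
    have GX: "\<G> X = X ** K - D ** (E ** F)"
    proof -
      have "\<G> X = D ** \<G> Y"
        by (simp add: X_def \<G>_def matrix_distribs matrix_mul_assoc DH)
      also have "\<dots> = (D ** F) ** K - D ** (E ** F)" by (simp add: GY matrix_distribs matrix_mul_assoc)
      also have "D ** F = X"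
        unfolding FY by (simp add: matrix_add_ldistrib X_def) (simp add: D_def matrix_distribs Pp p_simps)
      finally show ?thesis .
    qed
    have GW: "\<G> W = W ** K - (mat 1 - P) ** (E ** F)"
    proof -
      have "\<G> W = \<G> Y - P ** \<G> Y"
        by (simp add: W_def \<G>_def matrix_distribs matrix_mul_assoc HP)
      also have "\<dots> = (F - P ** F) ** K - (mat 1 - P) ** (E ** F)"
        by (simp add: GY matrix_distribs matrix_mul_assoc)
      also have "F - P ** F = W"
        unfolding FY by (simp add: W_def matrix_distribs Pp)
      finally show ?thesis .
    qed
    have nX: "norm X \<le> q * (c0 * s)"
      unfolding X_def D_def q_def by (rule order_trans[OF norm_matrix_mult]) (intro mult_left_mono nY norm_ge_zero)
    have "W = (mat 1 - P) ** Y" by (simp add: W_def matrix_distribs)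
    then have nW: "norm W \<le> c0 * s"
      using norm_orthogonal_projector[OF orthogonal_projector_complement[OF P], of Y] nY by simp
    \<comment> \<open>Inside the range of \<open>P\<close> the error \<open>E\<close> is small from the left too: \<open>P ** E = (P - Q) ** E\<close>.\<close>
    have nDEF: "norm (D ** (E ** F)) \<le> q * (d * (b0 * s))"
    proof -
      have "D ** P = D" using pP by (simp add: D_def matrix_distribs P_simps)
      then have "D ** (E ** F) = D ** ((P - Q) ** (E ** F))"
        using admissible_range[OF E] by (metis matrix_mul_assoc)
      also have "norm \<dots> \<le> q * norm ((P - Q) ** (E ** F))"
        unfolding q_def D_def by (rule norm_matrix_mult)
      also have "\<dots> \<le> q * (d * norm (E ** F))"
        unfolding d_def using q by (intro mult_left_mono norm_matrix_mult)
      also have "\<dots> \<le> q * (d * (b0 * s))"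
        using q d0 nEF by (intro mult_left_mono) auto
      finally show ?thesis .
    qed
    have gX: "X \<bullet> \<G> X \<le> k3 * d * e"
    proof -
      have "norm (X ** K) \<le> norm X * norm K" by (rule norm_matrix_mult)
      also have "\<dots> \<le> (q * (c0 * s)) * (k1 * d)"
        using nX nK q c0 s by (intro mult_mono) auto
      finally have "norm (\<G> X) \<le> (q * (c0 * s)) * (k1 * d) + q * (d * (b0 * s))"
        unfolding GX using nDEF norm_triangle_ineq4[of "X ** K" "D ** (E ** F)"] by linarith
      also have "\<dots> = (q * c0 * k1 + q * b0) * d * s" by (simp add: algebra_simps)
      finally have nG: "norm (\<G> X) \<le> (q * c0 * k1 + q * b0) * d * s" .
      have "X \<bullet> \<G> X \<le> norm X * norm (\<G> X)" by (rule norm_cauchy_schwarz)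
      also have "\<dots> \<le> (q * (c0 * s)) * ((q * c0 * k1 + q * b0) * d * s)"
        using nX nG q c0 s by (intro mult_mono) auto
      also have "\<dots> = k3 * d * (s * s)" by (simp add: k3_def mult_ac)
      finally show ?thesis by (simp add: s)
    qed
    have gX0: "0 \<le> X \<bullet> \<G> X" by (rule G_nonneg[OF Xod])
    \<comment> \<open>Here the lower bound \<open>l - a\<close> of \<open>\<G>\<close> on \<open>W\<close> and the inequality \<open>E\<^sup>2 \<le> b E\<close> meet.\<close>
    have gW: "(l - a) * (W \<bullet> \<G> W) \<le> b * \<phi> + k4 * d * e"
    proof -
      have low: "(l - a) * (norm W)^2 \<le> W \<bullet> \<G> W" by (rule G_lower_high[OF PW Wp])
      have cs: "W \<bullet> \<G> W \<le> norm W * norm (\<G> W)" by (rule norm_cauchy_schwarz)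
      have "(l - a) * norm W \<le> norm (\<G> W)"
      proof (cases "norm W = 0")
        case False
        have "((l - a) * norm W) * norm W \<le> norm (\<G> W) * norm W"
          using low cs by (simp add: power2_eq_square mult_ac)
        then show ?thesis using False by (simp add: mult_le_cancel_right)
      qed simp
      then have "(l - a) * norm W * norm (\<G> W) \<le> norm (\<G> W) * norm (\<G> W)"
        by (intro mult_right_mono) auto
      moreover have "(l - a) * (W \<bullet> \<G> W) \<le> (l - a) * (norm W * norm (\<G> W))"
        using cs al by (intro mult_left_mono) auto
      ultimately have 1: "(l - a) * (W \<bullet> \<G> W) \<le> (norm (\<G> W))^2"
        by (simp add: power2_eq_square mult_ac)
      have "norm (W ** K) \<le> norm W * norm K" by (rule norm_matrix_mult)
      also have "\<dots> \<le> (c0 * s) * (k1 * d)"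
        using nW nK c0 s by (intro mult_mono) auto
      finally have WK: "norm (W ** K) \<le> c0 * k1 * d * s" by (simp add: mult_ac)
      have "norm (\<G> W) \<le> norm (E ** F) + c0 * k1 * d * s"
        unfolding GW using WK norm_triangle_ineq4[of "W ** K" "(mat 1 - P) ** (E ** F)"]
          norm_orthogonal_projector[OF orthogonal_projector_complement[OF P], of "E ** F"] by linarith
      then have "(norm (\<G> W))^2 \<le> (norm (E ** F) + c0 * k1 * d * s)^2"
        by (intro power_mono) auto
      also have "\<dots> = (norm (E ** F))^2 + 2 * norm (E ** F) * (c0 * k1 * d * s) + c0^2 * k1^2 * (d * d) * (s * s)"
        by (simp add: power2_eq_square algebra_simps)
      also have "\<dots> \<le> b * \<phi> + 2 * (b0 * s) * (c0 * k1 * d * s) + c0^2 * k1^2 * d * (s * s)"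
      proof (intro add_mono EF2)
        show "2 * norm (E ** F) * (c0 * k1 * d * s) \<le> 2 * (b0 * s) * (c0 * k1 * d * s)"
          using nEF c0 k1 d0 s by (intro mult_right_mono) auto
        have "d * d \<le> d" using d0 by (simp add: mult_left_le)
        then show "c0^2 * k1^2 * (d * d) * (s * s) \<le> c0^2 * k1^2 * d * (s * s)"
          by (intro mult_right_mono mult_left_mono) auto
      qed
      also have "\<dots> = b * \<phi> + k4 * d * (s * s)" by (simp add: k4_def algebra_simps)
      finally show ?thesis using 1 by (simp add: s)
    qed
    have g: "Y \<bullet> \<G> Y = X \<bullet> \<G> X + W \<bullet> \<G> W"
    proof -
      have "X \<bullet> \<G> W = Y \<bullet> (P ** \<G> W)"
        unfolding XPY by (rule inner_hermitian[OF P_simps(1)])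
      also have "P ** \<G> W = \<G> (P ** W)" by (simp add: \<G>_def matrix_distribs matrix_mul_assoc HP)
      finally have "X \<bullet> \<G> W = 0" by (simp add: PW) (simp add: \<G>_def)
      then show ?thesis
        unfolding YXW by (simp add: G_add inner_add_left inner_add_right G_symmetric[of W X])
    qed
    have YK: "\<bar>Y \<bullet> (Y ** K)\<bar> \<le> k1 * C0 * d * e"
    proof -
      have "\<bar>Y \<bullet> (Y ** K)\<bar> \<le> norm Y * norm Y * (k1 * d)"
        unfolding K_def k1_def d_def by (rule coupling_error[OF E F])
      also have "\<dots> \<le> (C0 * e) * (k1 * d)"
        using Y2 k1 d0 by (intro mult_right_mono) (auto simp: power2_eq_square)
      finally show ?thesis by (simp add: mult_ac)
    qed
    have ident: "e + Y \<bullet> (Y ** K) = (X \<bullet> \<G> X + W \<bullet> \<G> W) + \<phi>"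
      using energy_identity[OF F] by (simp add: Y_def[symmetric] K_def[symmetric] e_def[symmetric] \<phi>_def[symmetric] g)
    have "W \<bullet> \<G> W + \<phi> \<le> e + k1 * C0 * d * e"
      using ident gX0 YK by linarith
    then have "b * (W \<bullet> \<G> W) + b * \<phi> \<le> b * e + b * (k1 * C0 * d * e)"
      using b by (metis distrib_left less_imp_le mult_left_mono)
    with gW have "(b + (l - a)) * (W \<bullet> \<G> W) \<le> b * e + b * (k1 * C0 * d * e) + k4 * d * e"
      by (simp add: distrib_right)
    also have "\<dots> = b * ((1 + k5 * d) * e)"
      using b by (simp add: k5_def field_simps)
    finally have "W \<bullet> \<G> W \<le> \<gamma> * ((1 + k5 * d) * e)"
      using b al by (simp add: \<gamma>_def field_simps)
    then have "Y \<bullet> \<G> Y \<le> k3 * d * e + \<gamma> * ((1 + k5 * d) * e)"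
      using g gX by linarith
    also have "\<dots> = \<gamma> * (1 + (k5 + k3 / \<gamma>) * d) * e"
      using gamma by (simp add: field_simps)
    finally show ?thesis using Y2 by (simp add: Y_def d_def e_def)
  qed
  show thesis
  proof (rule that[OF C \<epsilon>])
    fix E Q F assume A: "admissible E Q" "graph_projector E F" "norm (P - Q) \<le> \<epsilon>"
    have "0 \<le> C0 * energy E F" using main[OF A] by (smt (verit) zero_le_power2)
    then have e0: "0 \<le> energy E F" using C0 by (simp add: zero_le_mult_iff)
    have "C0 \<le> C" using k5 k3 gamma by (simp add: C_def)
    then show "(norm (F - p))^2 \<le> C * energy E F"
      using main[OF A] e0 mult_right_mono order_trans by blast
    have "k5 + k3 / \<gamma> \<le> C" using C0 by (simp add: C_def)
    then have "\<gamma> * (1 + (k5 + k3 / \<gamma>) * norm (P - Q)) * energy E F \<le> \<gamma> * (1 + C * norm (P - Q)) * energy E F"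
      using e0 gamma by (intro mult_right_mono mult_left_mono add_left_mono) auto
    then show "(F - p) \<bullet> \<G> (F - p) \<le> \<gamma> * (1 + C * norm (P - Q)) * energy E F"
      using main[OF A] by linarith
  qed
qed

text \<open>As \<open>E'\<close> vanishes on the range of \<open>F\<close>, testing \<open>E' ** F'\<close> with \<open>p\<close> is the same as testing it
  with \<open>- (F - p)\<close>; then the Riccati equation of the next step is inserted.\<close>

lemma energy_step_identity:
  assumes F: "graph_projector E F" and F': "graph_projector E' F'" and E': "hermitian E'"
    and kill: "E' ** F = 0"
  defines "Y \<equiv> F - p" and "Y' \<equiv> F' - p"
  shows "energy E' F' = Y \<bullet> \<G> Y' - Y \<bullet> (Y' ** (p ** E' ** F'))"
proof -
  have Y: "off_diagonal Y" unfolding Y_def by (rule graph_offset[OF F])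
  have "0 = F \<bullet> (E' ** F')" using inner_hermitian[OF E', of F F'] kill by simp
  also have "\<dots> = energy E' F' + Y \<bullet> (E' ** F')"
    by (simp add: energy_def Y_def inner_diff_left)
  also have "E' ** F' = p ** (p ** E' ** F') + Y' ** (p ** E' ** F') - \<G> Y'"
    unfolding Y'_def riccati[OF F'] by (simp add: matrix_diff_rdistrib riccati[OF F', symmetric] matrix_mul_assoc)
  finally show ?thesis
    by (simp only: inner_diff_right inner_add_right inner_p_off_diagonal[OF Y])
qed

text \<open>By \<open>energy_step_identity\<close> and Cauchy-Schwarz for \<open>\<G>\<close>, the new energy is at most the geometric mean
  of the forms \<open>Y \<bullet> \<G> Y\<close> of two consecutive steps, each of which is at most \<open>\<gamma>\<close> times its energy;
  one square root of the new energy cancels.\<close>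

lemma energy_contraction:
  obtains C \<epsilon> where "0 < C" "0 < \<epsilon>"
    "\<And>E Q F. \<lbrakk>admissible E Q; graph_projector E F; norm (P - Q) \<le> \<epsilon>\<rbrakk> \<Longrightarrow> (norm (F - p))^2 \<le> C * energy E F"
    "\<And>E Q F E' Q' F'. \<lbrakk>admissible E Q; graph_projector E F; norm (P - Q) \<le> \<epsilon>;
        admissible E' Q'; graph_projector E' F'; norm (P - Q') \<le> \<epsilon>; E' ** F = 0\<rbrakk> \<Longrightarrow>
       sqrt (energy E' F') \<le> \<gamma> * (1 + C * (norm (P - Q) + norm (P - Q'))) * sqrt (energy E F)"
proof -
  obtain C \<epsilon> where C: "0 < C" and \<epsilon>: "0 < \<epsilon>"
    and offset: "\<And>E Q F. \<lbrakk>admissible E Q; graph_projector E F; norm (P - Q) \<le> \<epsilon>\<rbrakk> \<Longrightarrow> (norm (F - p))^2 \<le> C * energy E F"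
    and form: "\<And>E Q F. \<lbrakk>admissible E Q; graph_projector E F; norm (P - Q) \<le> \<epsilon>\<rbrakk> \<Longrightarrow>
       (F - p) \<bullet> \<G> (F - p) \<le> \<gamma> * (1 + C * norm (P - Q)) * energy E F"
    by (rule energy_estimate) blast
  define k1 where "k1 = 2 * b * (norm p)^2"
  define C' where "C' = C + C * k1 / \<gamma>"
  have k1: "0 \<le> k1" using b by (simp add: k1_def)
  have CC': "C \<le> C'" using C k1 gamma by (simp add: C'_def)
  show thesis
  proof (rule that[of C' \<epsilon>])
    show "0 < C'" "0 < \<epsilon>" using C CC' \<epsilon> by auto
  next
    fix E Q F assume A: "admissible E Q" "graph_projector E F" "norm (P - Q) \<le> \<epsilon>"
    have "0 \<le> C * energy E F" using offset[OF A] by (smt (verit) zero_le_power2)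
    then have "0 \<le> energy E F" using C by (simp add: zero_le_mult_iff)
    then show "(norm (F - p))^2 \<le> C' * energy E F"
      using offset[OF A] CC' mult_right_mono order_trans by blast
  next
    fix E Q F E' Q' F'
    assume A: "admissible E Q" "graph_projector E F" "norm (P - Q) \<le> \<epsilon>"
      and A': "admissible E' Q'" "graph_projector E' F'" "norm (P - Q') \<le> \<epsilon>" and kill: "E' ** F = 0"
    define d d' where "d = norm (P - Q)" and "d' = norm (P - Q')"
    define s s' where "s = sqrt (energy E F)" and "s' = sqrt (energy E' F')"
    define Y Y' where "Y = F - p" and "Y' = F' - p"
    have d: "0 \<le> d" "0 \<le> d'" by (simp_all add: d_def d'_def)
    have nonneg: "0 \<le> energy E F" "0 \<le> energy E' F'"
      using offset[OF A] offset[OF A'] C zero_le_mult_iff by (smt (verit) zero_le_power2)+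
    then have s: "0 \<le> s" "0 \<le> s'" "s' * s' = energy E' F'" by (simp_all add: s_def s'_def)
    have "norm Y \<le> sqrt (C * energy E F)" "norm Y' \<le> sqrt (C * energy E' F')"
      unfolding Y_def Y'_def by (intro real_le_rsqrt offset[OF A] offset[OF A'])+
    then have nY: "norm Y * norm Y' \<le> (sqrt C * s) * (sqrt C * s')"
      unfolding s_def s'_def real_sqrt_mult by (intro mult_mono) (use C nonneg in auto)
    have g: "sqrt (Y \<bullet> \<G> Y) * sqrt (Y' \<bullet> \<G> Y') \<le> \<gamma> * (1 + C * (d + d')) * (s * s')"
    proof -
      have "sqrt (Y \<bullet> \<G> Y) \<le> sqrt (\<gamma> * (1 + C * d) * energy E F)"
        using form[OF A] by (simp add: Y_def d_def)
      moreover have "sqrt (Y' \<bullet> \<G> Y') \<le> sqrt (\<gamma> * (1 + C * d') * energy E' F')"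
        using form[OF A'] by (simp add: Y'_def d'_def)
      ultimately have "sqrt (Y \<bullet> \<G> Y) * sqrt (Y' \<bullet> \<G> Y') \<le>
          sqrt (\<gamma> * (1 + C * d) * energy E F) * sqrt (\<gamma> * (1 + C * d') * energy E' F')"
        using G_nonneg[OF graph_offset[OF A(2)]] G_nonneg[OF graph_offset[OF A'(2)]] gamma d C nonneg
        by (intro mult_mono) (auto simp: Y_def Y'_def)
      also have "\<dots> = (sqrt \<gamma> * sqrt \<gamma>) * (sqrt (1 + C * d) * sqrt (1 + C * d')) * (s * s')"
        by (simp add: real_sqrt_mult s_def s'_def mult_ac)
      also have "sqrt \<gamma> * sqrt \<gamma> = \<gamma>" using gamma by simp
      also have "\<gamma> * (sqrt (1 + C * d) * sqrt (1 + C * d')) * (s * s') \<le> \<gamma> * (1 + C * (d + d')) * (s * s')"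
      proof -
        have "sqrt (1 + C * d) * sqrt (1 + C * d') \<le> sqrt (1 + C * (d + d')) * sqrt (1 + C * (d + d'))"
          using C d by (intro mult_mono) (auto simp: algebra_simps)
        also have "\<dots> = 1 + C * (d + d')" using C d by simp
        finally show ?thesis using gamma s by (intro mult_right_mono mult_left_mono) auto
      qed
      finally show ?thesis .
    qed
    have "energy E' F' \<le> Y \<bullet> \<G> Y' + \<bar>Y \<bullet> (Y' ** (p ** E' ** F'))\<bar>"
      using energy_step_identity[OF A(2) A'(2) _ kill] A'(1) by (simp add: admissible_def Y_def Y'_def)
    also have "\<dots> \<le> sqrt (Y \<bullet> \<G> Y) * sqrt (Y' \<bullet> \<G> Y') + norm Y * norm Y' * (k1 * d')"
      unfolding k1_def d'_def Y_def Y'_def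
      by (intro add_mono G_cauchy_schwarz graph_offset[OF A(2)] graph_offset[OF A'(2)] coupling_error[OF A'(1,2)])
    also have "\<dots> \<le> \<gamma> * (1 + C * (d + d')) * (s * s') + ((sqrt C * s) * (sqrt C * s')) * (k1 * d')"
      using g nY k1 d by (intro add_mono mult_right_mono) auto
    also have "\<dots> = (\<gamma> * (1 + C * (d + d')) + C * k1 * d') * s * s'"
    proof -
      have "(sqrt C * s) * (sqrt C * s') = (sqrt C * sqrt C) * (s * s')" by (simp only: mult_ac)
      also have "\<dots> = C * (s * s')" using C by simp
      finally show ?thesis by (simp add: algebra_simps)
    qed
    also have "\<dots> \<le> \<gamma> * (1 + C' * (d + d')) * s * s'"
    proof -
      have "\<gamma> * (1 + C' * (d + d')) = \<gamma> * (1 + C * (d + d')) + C * k1 * (d + d')"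
        using gamma by (simp add: C'_def field_simps)
      moreover have "C * k1 * d' \<le> C * k1 * (d + d')"
        using C k1 d by (intro mult_left_mono) auto
      ultimately show ?thesis using s by (intro mult_right_mono) auto
    qed
    finally have main: "s' * s' \<le> \<gamma> * (1 + C' * (d + d')) * s * s'" by (simp add: s)
    show "sqrt (energy E' F') \<le> \<gamma> * (1 + C' * (norm (P - Q) + norm (P - Q'))) * sqrt (energy E F)"
    proof (cases "s' = 0")
      case True
      have "0 \<le> \<gamma> * (1 + C' * (d + d')) * s" using gamma C CC' d s by simp
      then show ?thesis using True by (simp add: s_def s'_def d_def d'_def)
    next
      case False
      then have "s' \<le> \<gamma> * (1 + C' * (d + d')) * s" using mult_right_le_imp_le[OF main] s by simp
      then show ?thesis by (simp add: s_def s'_def d_def d'_def)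
    qed
  qed
qed

lemma graph_projector_exists:
  assumes R: "orthogonal_projector R" and close: "norm (R - p) \<le> 1 / 4"
    and inv: "(H + E) ** R = R ** (H + E)"
  obtains F where "graph_projector E F" "R ** F = F" "F ** R = R"
proof -
  obtain F where F: "p ** F = p" "F ** p = F" "R ** F = F" "F ** R = R" "norm F \<le> 2 * norm p"
    using oblique_projector[OF p R close] by blast
  have "(H + E) ** F = R ** ((H + E) ** F)"
    using F(3) inv by (metis matrix_mul_assoc)
  then have "(H + E) ** F = F ** ((H + E) ** F)"
    using F(4) by (metis matrix_mul_assoc)
  with F show ?thesis by (intro that[of F]) (simp_all add: graph_projector_def)
qed

text \<open>The part of \<open>R\<close> outside the range of \<open>p\<close> is \<open>(F - p) ** R\<close>.\<close>

lemma projector_error_le_offset: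
  assumes R: "orthogonal_projector R" and rank: "norm R = norm p"
    and F: "F ** R = R"
  shows "norm (R - p) \<le> sqrt 2 * norm (F - p)"
proof -
  have "R - p ** R = (F - p) ** R" using F by (simp add: matrix_distribs)
  then have "norm (R - p ** R) = norm (R ** conj_transpose (F - p))"
    using orthogonal_projectorD(4)[OF R] by (metis conj_transpose_mult norm_conj_transpose)
  also have "\<dots> \<le> norm (F - p)"
    using norm_orthogonal_projector[OF R, of "conj_transpose (F - p)"] by simp
  finally have "(norm (R - p ** R))^2 \<le> (norm (F - p))^2" by (intro power_mono) auto
  then have "(norm (R - p))^2 \<le> (sqrt 2 * norm (F - p))^2"
    unfolding norm_projector_diff[OF p R rank] by (simp add: power_mult_distrib)
  then show ?thesis by (rule power2_le_imp_le) simp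
qed

text \<open>By \<open>ky_fan\<close> for \<open>H\<close>, the squared error is at most a multiple of \<open>R \<bullet> H - p \<bullet> H\<close>. By optimality of
  \<open>R\<close> for \<open>H + E\<close> and \<open>E \<ge> 0\<close> this is at most \<open>p \<bullet> E\<close>, and \<open>E\<close> meets \<open>p\<close> on both sides only
  through \<open>P - Q\<close>, so \<open>p \<bullet> E\<close> is quadratic in it. The bound is global, so it
  also brings the iteration into the local regime.\<close>

lemma projector_error_le:
  assumes E: "admissible E Q" and R: "orthogonal_projector R" and rank: "norm R = norm p"
    and opt: "R \<bullet> (H + E) \<le> p \<bullet> (H + E)"
  shows "norm (R - p) \<le> sqrt (2 * b / (c - a)) * norm p * norm (P - Q)"
proof -
  have hE: "hermitian E" and EQ: "E ** Q = 0" and hQ: "hermitian Q" using E by (auto simp: admissible_def)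
  have "R \<bullet> E = R \<bullet> (E ** R)"
    using inner_hermitian_right[OF orthogonal_projectorD(1)[OF R], of R E] orthogonal_projectorD(2)[OF R] by simp
  then have RE: "0 \<le> R \<bullet> E" using admissible_norm(2)[OF E, of R] by simp
  let ?D = "(P - Q) ** p"
  have "p \<bullet> E = p \<bullet> (E ** p)"
    using inner_hermitian_right[OF p_simps(1), of p E] p_simps(2) by simp
  also have "p = ?D + Q ** p" by (simp add: matrix_distribs Pp)
  then have "p \<bullet> (E ** p) = (?D + Q ** p) \<bullet> (E ** (?D + Q ** p))" by simp
  also have "\<dots> = ?D \<bullet> (E ** ?D)"
  proof -
    have "E ** (?D + Q ** p) = E ** ?D"
      by (simp add: matrix_add_ldistrib matrix_mul_assoc EQ)
    moreover have "(Q ** p) \<bullet> (E ** ?D) = 0"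
      using inner_hermitian[OF hE, of "Q ** p" ?D] by (simp add: matrix_mul_assoc EQ)
    ultimately show ?thesis by (simp add: inner_add_left)
  qed
  also have "\<dots> \<le> norm ?D * norm (E ** ?D)" by (rule norm_cauchy_schwarz)
  also have "\<dots> \<le> norm ?D * (b * norm ?D)"
    by (intro mult_left_mono admissible_norm(1)[OF E]) simp
  also have "\<dots> = b * (norm ?D)^2" by (simp add: power2_eq_square)
  also have "\<dots> \<le> b * (norm (P - Q) * norm p)^2"
    using b by (intro mult_left_mono power_mono norm_matrix_mult) auto
  finally have pE: "p \<bullet> E \<le> b * (norm (P - Q) * norm p)^2" .
  have "(c - a) / 2 * (norm (R - p))^2 \<le> R \<bullet> H - p \<bullet> H"
    using ky_fan[OF low R rank] by simp
  also have "\<dots> \<le> b * (norm (P - Q) * norm p)^2"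
    using opt RE pE by (simp add: inner_add_right)
  finally have "(norm (R - p))^2 \<le> 2 * b / (c - a) * (norm p * norm (P - Q))^2"
    using ac by (simp add: field_simps)
  also have "\<dots> = (sqrt (2 * b / (c - a)) * norm p * norm (P - Q))^2"
    using ac b by (simp add: power_mult_distrib)
  finally show ?thesis by (rule power2_le_imp_le) (use ac b in auto)
qed

text \<open>A quantitative form of \<open>lowest_block_nested\<close>, for \<open>R\<close> near \<open>p\<close> and \<open>S\<close> near \<open>P\<close>. The defect \<open>Z\<close>
  commutes with \<open>H + E\<close>; seen from the left it is almost above the level \<open>l\<close>, seen from the right almost
  below the level \<open>a\<close>. If the bracket is less than \<open>l - a\<close>, the range of \<open>R\<close> lies in the range of
  \<open>S\<close>, even where eigenvalues of \<open>H + E\<close> coincide and the choice of eigenvectors was free.\<close>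

lemma inclusion_defect:
  assumes E: "admissible E Q" and R: "orthogonal_projector R" and S: "orthogonal_projector S"
    and inv: "(H + E) ** R = R ** (H + E)" "(H + E) ** S = S ** (H + E)"
  defines "Z \<equiv> R - S ** R"
  shows "(l - a) * (norm Z)^2 \<le> (b * norm (R - p) + b * norm (P - Q) * norm p
      + (norm H + \<bar>l\<bar>) * (norm (P - S))^2 + (norm H + \<bar>a\<bar>) * (norm (R - p))^2) * (norm Z)^2"
proof -
  note R' = orthogonal_projectorD[OF R] and S' = orthogonal_projectorD[OF S]
  have SZ: "S ** Z = 0" by (simp add: Z_def matrix_distribs S')
  have ZR: "Z ** R = Z" by (simp add: Z_def matrix_distribs R' flip: matrix_mul_assoc)
  have hE: "hermitian E" using E by (simp add: admissible_def)
  have comm: "(H + E) ** Z = Z ** (H + E)"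
  proof -
    have "(H + E) ** (S ** R) = (S ** R) ** (H + E)" using inv by (metis matrix_mul_assoc)
    then show ?thesis using inv by (simp add: Z_def matrix_diff_ldistrib matrix_diff_rdistrib)
  qed
  have HX: "\<bar>X \<bullet> (H ** X)\<bar> \<le> norm H * (norm X)^2" for X :: "complex^'N^'N"
  proof -
    have "\<bar>X \<bullet> (H ** X)\<bar> \<le> norm X * norm (H ** X)" by (rule Cauchy_Schwarz_ineq2)
    also have "\<dots> \<le> norm X * (norm H * norm X)" by (intro mult_left_mono norm_matrix_mult) simp
    finally show ?thesis by (simp add: power2_eq_square mult_ac)
  qed
  have lower: "l * (norm Z)^2 - (norm H + \<bar>l\<bar>) * ((norm (P - S))^2 * (norm Z)^2) \<le> Z \<bullet> (H ** Z)"
  proof -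
    have "P ** Z = (P - S) ** Z" by (simp add: matrix_distribs SZ)
    then have "(norm (P ** Z))^2 \<le> (norm (P - S) * norm Z)^2"
      by (intro power_mono) (simp_all add: norm_matrix_mult)
    then have small: "(norm H + \<bar>l\<bar>) * (norm (P ** Z))^2 \<le> (norm H + \<bar>l\<bar>) * ((norm (P - S))^2 * (norm Z)^2)"
      by (intro mult_left_mono) (simp_all add: power_mult_distrib)
    have "P ** (Z - P ** Z) = 0" by (simp add: matrix_distribs P_simps)
    then have "l * (norm (Z - P ** Z))^2 \<le> (Z - P ** Z) \<bullet> (H ** (Z - P ** Z))" by (rule high)
    moreover have "l * (norm (P ** Z))^2 \<le> \<bar>l\<bar> * (norm (P ** Z))^2" by (intro mult_right_mono) auto
    moreover have "l * (norm Z)^2 = l * (norm (P ** Z))^2 + l * (norm (Z - P ** Z))^2"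
      using norm_projector_split[OF P, of Z] by (simp add: distrib_left)
    ultimately show ?thesis
      using inner_projector_split[OF P HP, of Z] HX[of "P ** Z"] small by (simp add: distrib_right)
  qed
  have upper: "Z \<bullet> (Z ** H) \<le> a * (norm Z)^2 + (norm H + \<bar>a\<bar>) * ((norm (R - p))^2 * (norm Z)^2)"
  proof -
    define T where "T = conj_transpose Z"
    have "conj_transpose (T - p ** T) = Z - Z ** p"
      by (simp add: T_def conj_transpose_diff conj_transpose_mult p_simps)
    also have "\<dots> = Z ** (R - p)" by (simp add: matrix_distribs ZR)
    finally have "norm (T - p ** T) = norm (Z ** (R - p))" by (metis norm_conj_transpose)
    also have "\<dots> \<le> norm Z * norm (R - p)" by (rule norm_matrix_mult)
    finally have "(norm (T - p ** T))^2 \<le> (norm Z * norm (R - p))^2" by (intro power_mono) auto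
    then have small: "(norm H + \<bar>a\<bar>) * (norm (T - p ** T))^2 \<le> (norm H + \<bar>a\<bar>) * ((norm (R - p))^2 * (norm Z)^2)"
      by (intro mult_left_mono) (simp_all add: power_mult_distrib mult_ac)
    have "p ** (p ** T) = p ** T" by (rule p_simps)
    then have "(p ** T) \<bullet> (H ** (p ** T)) \<le> a * (norm (p ** T))^2" by (rule up)
    moreover have "- a * (norm (T - p ** T))^2 \<le> \<bar>a\<bar> * (norm (T - p ** T))^2" by (intro mult_right_mono) auto
    moreover have "a * (norm T)^2 = a * (norm (p ** T))^2 + a * (norm (T - p ** T))^2"
      using norm_projector_split[OF p, of T] by (simp add: distrib_left)
    ultimately have "T \<bullet> (H ** T) \<le> a * (norm T)^2 + (norm H + \<bar>a\<bar>) * ((norm (R - p))^2 * (norm Z)^2)"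
      using inner_projector_split[OF p Hp, of T] HX[of "T - p ** T"] small by (simp add: distrib_right)
    moreover have "T \<bullet> (H ** T) = Z \<bullet> (Z ** H)"
      using inner_conj_transpose[of Z "Z ** H"] H by (simp add: T_def conj_transpose_mult hermitian_def)
    ultimately show ?thesis by (simp add: T_def)
  qed
  have pert: "Z \<bullet> (Z ** E) \<le> (b * norm (R - p) + b * norm (P - Q) * norm p) * (norm Z)^2"
  proof -
    have "conj_transpose (E ** (R - p)) = (R - p) ** E"
      using hE by (simp add: conj_transpose_mult conj_transpose_diff hermitian_def R' p_simps)
    then have 1: "norm ((R - p) ** E) \<le> b * norm (R - p)"
      using admissible_norm(1)[OF E, of "R - p"] by (metis norm_conj_transpose)
    have "Z ** E = Z ** (R ** E)" using ZR by (metis matrix_mul_assoc)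
    also have "R ** E = (R - p) ** E + p ** E" by (simp add: matrix_distribs)
    finally have "norm (Z ** E) \<le> norm Z * norm ((R - p) ** E + p ** E)"
      using norm_matrix_mult by metis
    also have "\<dots> \<le> norm Z * (b * norm (R - p) + b * norm (P - Q) * norm p)"
      using 1 admissible_small(2)[OF E] by (intro mult_left_mono norm_triangle_le add_mono) auto
    finally have "norm Z * norm (Z ** E) \<le> norm Z * (norm Z * (b * norm (R - p) + b * norm (P - Q) * norm p))"
      by (intro mult_left_mono) auto
    with norm_cauchy_schwarz[of Z "Z ** E"] show ?thesis by (simp add: power2_eq_square mult_ac)
  qed
  have "Z \<bullet> (H ** Z) + Z \<bullet> (E ** Z) = Z \<bullet> (Z ** H) + Z \<bullet> (Z ** E)"
    using arg_cong[OF comm, of "\<lambda>X. Z \<bullet> X"] by (simp add: matrix_distribs inner_add_right)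
  then show ?thesis
    using lower upper pert admissible_norm(2)[OF E, of Z]
    by (simp add: left_diff_distrib distrib_right mult.assoc)
qed

text \<open>The quantity \<open>s k\<close> is the square root of the energy of the oblique projector onto the range of
  \<open>R k\<close>, which exists once \<open>R k\<close> is near \<open>p\<close>. The index shift matters: \<open>R k\<close> is computed from \<open>E k\<close> and
  lies in the range of \<open>Q (Suc k)\<close>, the projector that defines \<open>E (Suc k)\<close>.\<close>

lemma projector_sequence_rate:
  fixes E Q R :: "nat \<Rightarrow> complex^'N^'N"
  assumes adm: "\<And>k. admissible (E k) (Q k)"
    and R: "\<And>k. orthogonal_projector (R k)" "\<And>k. norm (R k) = norm p"
      "\<And>k. (H + E k) ** R k = R k ** (H + E k)"
    and opt: "\<And>k. R k \<bullet> (H + E k) \<le> p \<bullet> (H + E k)"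
    and lim: "Q \<longlonglongrightarrow> P"
    and nested: "eventually (\<lambda>k. Q (Suc k) ** R k = R k) sequentially"
  obtains C s k0 where "0 < C" "\<And>k. k0 \<le> k \<Longrightarrow> 0 \<le> s k" "\<And>k. k0 \<le> k \<Longrightarrow> norm (R k - p) \<le> C * s k"
    "\<And>k. k0 \<le> k \<Longrightarrow> s (Suc k) \<le> \<gamma> * (1 + C * (norm (P - Q k) + norm (P - Q (Suc k)))) * s k"
proof -
  obtain C \<epsilon> where C: "0 < C" and \<epsilon>: "0 < \<epsilon>"
    and offset: "\<And>E Q F. \<lbrakk>admissible E Q; graph_projector E F; norm (P - Q) \<le> \<epsilon>\<rbrakk> \<Longrightarrow> (norm (F - p))^2 \<le> C * energy E F"
    and contract: "\<And>E Q F E' Q' F'. \<lbrakk>admissible E Q; graph_projector E F; norm (P - Q) \<le> \<epsilon>;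
        admissible E' Q'; graph_projector E' F'; norm (P - Q') \<le> \<epsilon>; E' ** F = 0\<rbrakk> \<Longrightarrow>
       sqrt (energy E' F') \<le> \<gamma> * (1 + C * (norm (P - Q) + norm (P - Q'))) * sqrt (energy E F)"
    by (rule energy_contraction) blast
  have d0: "(\<lambda>k. norm (P - Q k)) \<longlonglongrightarrow> 0"
    using tendsto_norm[OF tendsto_diff[OF tendsto_const lim, of P]] by simp
  have "(\<lambda>k. sqrt (2 * b / (c - a)) * norm p * norm (P - Q k)) \<longlonglongrightarrow> sqrt (2 * b / (c - a)) * norm p * 0"
    by (intro tendsto_intros d0)
  then have "eventually (\<lambda>k. sqrt (2 * b / (c - a)) * norm p * norm (P - Q k) < 1 / 4) sequentially"
    by (rule order_tendstoD) simp
  moreover have "eventually (\<lambda>k. norm (P - Q k) < \<epsilon>) sequentially"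
    using d0 \<epsilon> by (rule order_tendstoD)
  ultimately have "eventually (\<lambda>k. norm (R k - p) \<le> 1 / 4 \<and> norm (P - Q k) \<le> \<epsilon> \<and> Q (Suc k) ** R k = R k) sequentially"
    using nested
  proof eventually_elim
    case (elim k)
    then show ?case using projector_error_le[OF adm R(1,2) opt, of k] by auto
  qed
  then obtain k0 where k0: "\<And>k. k0 \<le> k \<Longrightarrow> norm (R k - p) \<le> 1 / 4 \<and> norm (P - Q k) \<le> \<epsilon> \<and> Q (Suc k) ** R k = R k"
    unfolding eventually_sequentially by blast
  have "\<forall>k. \<exists>F. k0 \<le> k \<longrightarrow> graph_projector (E k) F \<and> R k ** F = F \<and> F ** R k = R k"
    using graph_projector_exists[OF R(1) _ R(3)] k0 by metis
  then obtain F where F: "\<And>k. k0 \<le> k \<Longrightarrow> graph_projector (E k) (F k) \<and> R k ** F k = F k \<and> F k ** R k = R k"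
    by metis
  define s where "s k = sqrt (energy (E k) (F k))" for k
  define C' where "C' = C + sqrt 2 * sqrt C"
  show thesis
  proof (rule that[of C' k0 s])
    show "0 < C'" using C by (simp add: C'_def add_pos_nonneg)
  next
    fix k assume k: "k0 \<le> k"
    have off: "(norm (F k - p))^2 \<le> C * energy (E k) (F k)" using offset adm F k0 k by blast
    then have "0 \<le> C * energy (E k) (F k)" by (smt (verit) zero_le_power2)
    then have e: "0 \<le> energy (E k) (F k)" using C by (simp add: zero_le_mult_iff)
    then show s: "0 \<le> s k" by (simp add: s_def)
    have "norm (R k - p) \<le> sqrt 2 * norm (F k - p)"
      using F[OF k] by (intro projector_error_le_offset R) auto
    also have "\<dots> \<le> sqrt 2 * (sqrt C * s k)"
      using real_le_rsqrt[OF off] by (simp add: s_def real_sqrt_mult)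
    also have "\<dots> \<le> C' * s k" using C s by (simp add: C'_def algebra_simps)
    finally show "norm (R k - p) \<le> C' * s k" .
    have "E (Suc k) ** F k = E (Suc k) ** Q (Suc k) ** (R k ** F k)"
      using F[OF k] k0[OF k] by (metis matrix_mul_assoc)
    also have "\<dots> = 0" using adm[of "Suc k"] by (simp add: admissible_def)
    finally have kill: "E (Suc k) ** F k = 0" .
    have "s (Suc k) \<le> \<gamma> * (1 + C * (norm (P - Q k) + norm (P - Q (Suc k)))) * s k"
      unfolding s_def using F k0 k by (intro contract[OF adm _ _ adm _ _ kill]) auto
    also have "\<dots> \<le> \<gamma> * (1 + C' * (norm (P - Q k) + norm (P - Q (Suc k)))) * s k"
      using gamma s C by (intro mult_right_mono mult_left_mono add_left_mono) (auto simp: C'_def)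
    finally show "s (Suc k) \<le> \<gamma> * (1 + C' * (norm (P - Q k) + norm (P - Q (Suc k)))) * s k" .
  qed
qed

end

section \<open>Convergence of the iteration\<close>

text \<open>The product of the factors \<open>1 + \<delta> j\<close> is at most \<open>exp (suminf \<delta>)\<close>, so the rate is \<open>g\<close> itself and not merely
  every number above \<open>g\<close>.\<close>

lemma perturbed_geometric_decay:
  fixes s \<delta> :: "nat \<Rightarrow> real"
  assumes g: "0 < g" and \<delta>: "summable \<delta>" "\<And>k. 0 \<le> \<delta> k"
    and s: "\<And>k. k0 \<le> k \<Longrightarrow> 0 \<le> s k" "\<And>k. k0 \<le> k \<Longrightarrow> s (Suc k) \<le> g * (1 + \<delta> k) * s k"
  obtains C where "0 < C" "\<And>k. k0 \<le> k \<Longrightarrow> s k \<le> C * g ^ k"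
proof -
  have step: "s k \<le> s k0 / g ^ k0 * g ^ k * exp (\<Sum>j<k. \<delta> j)" if "k0 \<le> k" for k
    using that
  proof (induction k rule: dec_induct)
    case base
    have "s k0 * 1 \<le> s k0 * exp (\<Sum>j<k0. \<delta> j)"
      using s \<delta> by (intro mult_left_mono) (auto intro: sum_nonneg)
    then show ?case using g by simp
  next
    case (step k)
    have "s (Suc k) \<le> g * (1 + \<delta> k) * s k" using step s by simp
    also have "\<dots> \<le> g * exp (\<delta> k) * s k"
      using g s step \<delta> exp_ge_add_one_self[of "\<delta> k"] by (intro mult_right_mono mult_left_mono) auto
    also have "\<dots> \<le> g * exp (\<delta> k) * (s k0 / g ^ k0 * g ^ k * exp (\<Sum>j<k. \<delta> j))"
      using step g by (intro mult_left_mono) auto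
    also have "\<dots> = s k0 / g ^ k0 * g ^ Suc k * exp (\<Sum>j<Suc k. \<delta> j)"
      by (simp add: exp_add mult_ac)
    finally show ?case .
  qed
  define C where "C = s k0 / g ^ k0 * exp (suminf \<delta>) + 1"
  show ?thesis
  proof (rule that)
    have nn: "0 \<le> s k0 / g ^ k0" using s g by simp
    then show "0 < C" unfolding C_def by (intro add_nonneg_pos mult_nonneg_nonneg) auto
    fix k assume k: "k0 \<le> k"
    have "s k \<le> s k0 / g ^ k0 * g ^ k * exp (\<Sum>j<k. \<delta> j)" by (rule step[OF k])
    also have "\<dots> \<le> s k0 / g ^ k0 * g ^ k * exp (suminf \<delta>)"
    proof (intro mult_left_mono mult_nonneg_nonneg nn)
      show "exp (\<Sum>j<k. \<delta> j) \<le> exp (suminf \<delta>)" using \<delta> by (simp add: sum_le_suminf)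
    qed (use g in auto)
    also have "\<dots> \<le> C * g ^ k" using g by (simp add: C_def algebra_simps)
    finally show "s k \<le> C * g ^ k" .
  qed
qed

text \<open>As \<open>d\<close> tends to zero, the contraction factor of \<open>s\<close> is eventually below \<open>(1 + g) / 2 < 1\<close>, and \<open>s\<close>
  dominates \<open>d\<close>.\<close>

lemma summable_of_contraction:
  fixes s d :: "nat \<Rightarrow> real"
  assumes g: "0 < g" "g < 1" and d: "\<And>k. 0 \<le> d k" "d \<longlonglongrightarrow> 0" and C: "0 < C"
    and s: "\<And>k. k0 \<le> k \<Longrightarrow> 0 \<le> s k" "\<And>k. k0 \<le> k \<Longrightarrow> d (Suc k) \<le> C * s k"
      "\<And>k. k0 \<le> k \<Longrightarrow> s (Suc k) \<le> g * (1 + C * (d k + d (Suc k))) * s k"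
  shows "summable d"
proof -
  have "(\<lambda>k. g * (1 + C * (d k + d (Suc k)))) \<longlonglongrightarrow> g * (1 + C * (0 + 0))"
    by (intro tendsto_intros d LIMSEQ_Suc[OF d(2)])
  then have "eventually (\<lambda>k. g * (1 + C * (d k + d (Suc k))) < (1 + g) / 2) sequentially"
    by (rule order_tendstoD) (use g in simp)
  then obtain k1 where k1: "\<And>k. k1 \<le> k \<Longrightarrow> g * (1 + C * (d k + d (Suc k))) < (1 + g) / 2"
    unfolding eventually_sequentially by blast
  have "summable s"
  proof (rule summable_ratio_test[of "(1 + g) / 2" "max k0 k1"])
    fix k assume "max k0 k1 \<le> k"
    then have k: "k0 \<le> k" "k1 \<le> k" by auto
    have "s (Suc k) \<le> g * (1 + C * (d k + d (Suc k))) * s k" by (rule s[OF k(1)])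
    also have "\<dots> \<le> (1 + g) / 2 * s k"
      using k1[OF k(2)] s(1)[OF k(1)] by (intro mult_right_mono) auto
    finally show "norm (s (Suc k)) \<le> (1 + g) / 2 * norm (s k)"
      using s(1)[OF k(1)] s(1)[of "Suc k"] k by simp
  qed (use g in simp)
  then have "summable (\<lambda>k. C * s k)" by (rule summable_mult)
  then have "summable (\<lambda>k. d (Suc k))"
    by (rule summable_comparison_test'[of _ k0]) (use s d in auto)
  then show ?thesis by (simp only: summable_Suc_iff)
qed

theorem theorem1p8:
  fixes A B P P\<^sub>m :: "complex^'N^'N"
    and F :: "complex^'N^'N \<Rightarrow> complex^'N^'N"
    and Pk Pmk :: "nat \<Rightarrow> complex^'N^'N"
    and m n :: nat
  assumes "1 \<le> m" and "m < n" and "n < CARD('N)"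
    and "hermitian A" and "hermitian B" and "negative_definite B"
    and "nth_eigenvalue (n + 1) (A + B) - nth_eigenvalue n (A + B) > 0"
    and "nth_eigenvalue (m + 1) (A + B) - nth_eigenvalue m (A + B) > 0"
    and "lowest_spectral_projector n (A + B) P"
    and "lowest_spectral_projector m (A + B) P\<^sub>m"
    and "fixed_point_map n A B F"
    and "Pk 0 \<in> rank_projectors n"
    and "\<And>k. Pk (k + 1) = F (Pk k)"
    and "\<And>k. k \<ge> 1 \<Longrightarrow>
           lowest_spectral_projector m (A + adaptive_compression B (Pk (k - 1))) (Pmk k)"
    and "Pk \<longlonglongrightarrow> P"
  defines "\<Delta>\<^sub>m \<equiv> nth_eigenvalue (n + 1) (A + B) - nth_eigenvalue m (A + B)"
  shows "Pmk \<longlonglongrightarrow> P\<^sub>m \<and>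
    (\<exists>\<gamma>\<^sub>m C. \<gamma>\<^sub>m \<le> spectral_norm B / (spectral_norm B + \<Delta>\<^sub>m) \<and> C > 0 \<and>
      (\<forall>k\<ge>1. spectral_norm (P\<^sub>m - Pmk k) \<le> C * \<gamma>\<^sub>m ^ k * spectral_norm (P - Pk 0)))"
proof -
  let ?H = "A + B" and ?ev = "\<lambda>i. nth_eigenvalue i (A + B)" and ?b = "spectral_norm B"
  let ?d = "\<lambda>k. norm (P - Pk k)"
  have hH: "hermitian ?H" using assms(4,5) by (simp add: hermitian_def conj_transpose_add)
  have mN: "m < CARD('N)" and n1: "1 \<le> n" using assms(1-3) by auto
  define E where "E k = adaptive_compression B (Pk k) - B" for k
  have Hk: "A + adaptive_compression B (Pk k) = ?H + E k" for k by (simp add: E_def)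
  have rank: "Pk k \<in> rank_projectors n" and
    step: "\<exists>u. lowest_eigenvectors n (?H + E k) u \<and> Pk (Suc k) = (\<Sum>i=1..n. outer (u i))" for k
  proof -
    have next_proj: "\<exists>u. lowest_eigenvectors n (?H + E k) u \<and> Pk (Suc k) = (\<Sum>i=1..n. outer (u i))"
      if "Pk k \<in> rank_projectors n" for k
      using assms(11) assms(13)[of k] that by (simp add: fixed_point_map_def Hk[symmetric])
    show r: "Pk k \<in> rank_projectors n" for k
    proof (induction k)
      case 0 then show ?case by (rule assms(12))
    next
      case (Suc k)
      then show ?case using next_proj[OF Suc] sum_outer_lowest_projector(2) by metis
    qed
    show "\<exists>u. lowest_eigenvectors n (?H + E k) u \<and> Pk (Suc k) = (\<Sum>i=1..n. outer (u i))"
      by (rule next_proj[OF r])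
  qed
  have oPk: "orthogonal_projector (Pk k)" for k using rank by (simp add: rank_projectors_def)
  have lowPk: "lowest_spectral_projector n (?H + E k) (Pk (Suc k))" for k
    using step[of k] sum_outer_lowest_projector(1) by metis
  have lowPmk: "lowest_spectral_projector m (?H + E k) (Pmk (Suc k))" for k
    using assms(14)[of "Suc k"] by (simp add: Hk[symmetric])
  note err = compression_error[OF assms(6) oPk, folded E_def]
  have hHk: "hermitian (?H + E k)" for k
    using hH err(1)[of k] by (simp add: hermitian_def conj_transpose_add)
  note blockP = lowest_block_spectral[OF hH assms(9) n1 assms(3)]
  note blockPm = lowest_block_spectral[OF hH assms(10,1) mN]
  note blockPk = lowest_block_spectral[OF hHk lowPk n1 assms(3)]
  note blockPmk = lowest_block_spectral[OF hHk lowPmk assms(1) mN]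
  have gap: "?ev m < ?ev (n + 1)"
    using nth_eigenvalue_mono[OF hH, of m n] assms(1-3,7) by simp
  have nested: "P ** P\<^sub>m = P\<^sub>m" by (rule lowest_block_nested[OF hH blockPm blockP gap])
  have oP: "orthogonal_projector P" using blockP by (simp add: lowest_block_def)
  have bpos: "0 < ?b" by (rule negative_definite_spectral_norm_pos[OF assms(6)])
  \<comment> \<open>\<open>N\<close> treats the iteration for \<open>P\<close> itself and supplies summability; \<open>M\<close> treats \<open>P\<^sub>m\<close> and gives the rate.\<close>
  interpret N: two_level ?H P P "?ev n" "?ev (n + 1)" "?ev (n + 1)" ?b
    using blockP assms(7) bpos
    by unfold_locales (auto simp: lowest_block_def hH orthogonal_projector_def)
  interpret M: two_level ?H P\<^sub>m P "?ev m" "?ev (m + 1)" "?ev (n + 1)" ?b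
    using blockP blockPm assms(8) gap bpos nested
    by unfold_locales (auto simp: lowest_block_def hH orthogonal_projector_def)
  have hPk: "hermitian (Pk k)" for k using oPk by (simp add: orthogonal_projector_def)
  have admN: "N.admissible (E k) (Pk k)" and admM: "M.admissible (E k) (Pk k)" for k
    using err[of k] hPk by (auto simp: N.admissible_def M.admissible_def)
  have RN: "orthogonal_projector (Pk (Suc k))" "norm (Pk (Suc k)) = norm P"
    "(?H + E k) ** Pk (Suc k) = Pk (Suc k) ** (?H + E k)"
    "Pk (Suc k) \<bullet> (?H + E k) \<le> P \<bullet> (?H + E k)" for k
  proof -
    show nrm: "norm (Pk (Suc k)) = norm P"
      using lowest_spectral_projector_norm[OF lowPk[of k]] lowest_spectral_projector_norm[OF assms(9)] by simp
    have "0 \<le> nth_eigenvalue (n + 1) (?H + E k) - nth_eigenvalue n (?H + E k)"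
      using nth_eigenvalue_mono[OF hHk, of n "n + 1"] assms(3) n1 by simp
    then have "0 \<le> (nth_eigenvalue (n + 1) (?H + E k) - nth_eigenvalue n (?H + E k)) / 2 * (norm (P - Pk (Suc k)))^2"
      by simp
    with ky_fan[OF blockPk oP nrm[symmetric]]
    show "Pk (Suc k) \<bullet> (?H + E k) \<le> P \<bullet> (?H + E k)" by linarith
  qed (use blockPk[of k] oPk in \<open>auto simp: lowest_block_def\<close>)
  have RM: "orthogonal_projector (Pmk (Suc k))" "norm (Pmk (Suc k)) = norm P\<^sub>m"
    "(?H + E k) ** Pmk (Suc k) = Pmk (Suc k) ** (?H + E k)"
    "Pmk (Suc k) \<bullet> (?H + E k) \<le> P\<^sub>m \<bullet> (?H + E k)" for k
  proof -
    show nrm: "norm (Pmk (Suc k)) = norm P\<^sub>m"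
      using lowest_spectral_projector_norm[OF lowPmk[of k]] lowest_spectral_projector_norm[OF assms(10)] by simp
    have "0 \<le> nth_eigenvalue (m + 1) (?H + E k) - nth_eigenvalue m (?H + E k)"
      using nth_eigenvalue_mono[OF hHk, of m "m + 1"] assms(1) mN by simp
    then have "0 \<le> (nth_eigenvalue (m + 1) (?H + E k) - nth_eigenvalue m (?H + E k)) / 2 * (norm (P\<^sub>m - Pmk (Suc k)))^2"
      by simp
    with ky_fan[OF blockPmk M.p nrm[symmetric]]
    show "Pmk (Suc k) \<bullet> (?H + E k) \<le> P\<^sub>m \<bullet> (?H + E k)" by linarith
  qed (use blockPmk[of k] in \<open>auto simp: lowest_block_def\<close>)
  define KN where "KN = sqrt (2 * ?b / (?ev (n + 1) - ?ev n)) * norm P"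
  define KM where "KM = sqrt (2 * ?b / (?ev (m + 1) - ?ev m)) * norm P\<^sub>m"
  have closeN: "norm (Pk (Suc k) - P) \<le> KN * ?d k" for k
    unfolding KN_def by (rule N.projector_error_le[OF admN RN(1,2,4)])
  have closeM: "norm (Pmk (Suc k) - P\<^sub>m) \<le> KM * ?d k" for k
    unfolding KM_def by (rule M.projector_error_le[OF admM RM(1,2,4)])
  have d0: "?d \<longlonglongrightarrow> 0"
    using tendsto_norm[OF tendsto_diff[OF tendsto_const assms(15), of P]] by simp
  have KM0: "(\<lambda>k. KM * ?d k) \<longlonglongrightarrow> 0" using tendsto_mult_right_zero[OF d0] .
  have err0: "(\<lambda>k. norm (Pmk (Suc k) - P\<^sub>m)) \<longlonglongrightarrow> 0"
    by (rule tendsto_sandwich[OF _ _ tendsto_const KM0]) (simp_all add: closeM)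
  then have "(\<lambda>k. Pmk (Suc k) - P\<^sub>m) \<longlonglongrightarrow> 0" by (simp only: tendsto_norm_zero_iff)
  then have "(\<lambda>k. Pmk (Suc k)) \<longlonglongrightarrow> P\<^sub>m" by (simp only: LIM_zero_iff)
  then have conv: "Pmk \<longlonglongrightarrow> P\<^sub>m" by (rule LIMSEQ_imp_Suc)
  have summable: "summable ?d"
  proof -
    have "eventually (\<lambda>k. Pk (Suc k) ** Pk (Suc k) = Pk (Suc k)) sequentially"
      using oPk by (simp add: orthogonal_projector_def)
    then obtain C s k0 where *: "0 < C" "\<And>k. k0 \<le> k \<Longrightarrow> 0 \<le> s k" "\<And>k. k0 \<le> k \<Longrightarrow> norm (Pk (Suc k) - P) \<le> C * s k"
        "\<And>k. k0 \<le> k \<Longrightarrow> s (Suc k) \<le> N.\<gamma> * (1 + C * (?d k + ?d (Suc k))) * s k"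
      by (rule N.projector_sequence_rate[OF admN RN assms(15)]) (rule that)
    show ?thesis
      by (rule summable_of_contraction[OF N.gamma norm_ge_zero d0 *(1,2) _ *(4)])
        (use *(3) in \<open>auto simp: norm_minus_commute\<close>)
  qed
  have "eventually (\<lambda>k. Pk (Suc k) ** Pmk (Suc k) = Pmk (Suc k)) sequentially"
  proof -
    let ?\<rho> = "\<lambda>k. norm (Pmk (Suc k) - P\<^sub>m)"
    let ?f = "\<lambda>k. ?b * ?\<rho> k + ?b * ?d k * norm P\<^sub>m + (norm ?H + \<bar>?ev (n + 1)\<bar>) * (?d (Suc k))^2
        + (norm ?H + \<bar>?ev m\<bar>) * (?\<rho> k)^2"
    have "?f \<longlonglongrightarrow> ?b * 0 + ?b * 0 * norm P\<^sub>m + (norm ?H + \<bar>?ev (n + 1)\<bar>) * 0^2 + (norm ?H + \<bar>?ev m\<bar>) * 0^2"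
      by (intro tendsto_intros err0 d0 LIMSEQ_Suc[OF d0])
    then have "eventually (\<lambda>k. ?f k < ?ev (n + 1) - ?ev m) sequentially"
      by (rule order_tendstoD) (use gap in simp)
    then show ?thesis
    proof eventually_elim
      case (elim k)
      define Z where "Z = Pmk (Suc k) - Pk (Suc k) ** Pmk (Suc k)"
      have "(?ev (n + 1) - ?ev m) * (norm Z)^2 \<le> ?f k * (norm Z)^2"
        unfolding Z_def by (rule M.inclusion_defect[OF admM RM(1) RN(1) RM(3) RN(3)])
      then have "Z = 0" using elim by (metis linorder_not_less mult_less_cancel_right_pos norm_eq_zero zero_less_power2)
      then show ?case by (simp add: Z_def)
    qed
  qed
  then obtain C s k0 where C: "0 < C" and s: "\<And>k. k0 \<le> k \<Longrightarrow> 0 \<le> s k" "\<And>k. k0 \<le> k \<Longrightarrow> norm (Pmk (Suc k) - P\<^sub>m) \<le> C * s k"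
      "\<And>k. k0 \<le> k \<Longrightarrow> s (Suc k) \<le> M.\<gamma> * (1 + C * (?d k + ?d (Suc k))) * s k"
    by (rule M.projector_sequence_rate[OF admM RM assms(15)]) (rule that)
  have sm: "summable (\<lambda>k. C * (?d k + ?d (Suc k)))"
    using summable summable_Suc_iff[of ?d] by (intro summable_mult summable_add) auto
  have nn: "0 \<le> C * (?d k + ?d (Suc k))" for k using C by simp
  obtain C1 where C1: "0 < C1" "\<And>k. k0 \<le> k \<Longrightarrow> s k \<le> C1 * M.\<gamma> ^ k"
    by (rule perturbed_geometric_decay[of M.\<gamma> "\<lambda>k. C * (?d k + ?d (Suc k))" k0 s, OF M.gamma(1) sm nn s(1,3)]) (assumption+, rule that)
  have \<gamma>: "M.\<gamma> = ?b / (?b + \<Delta>\<^sub>m)" by (simp only: M.\<gamma>_def \<Delta>\<^sub>m_def)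
  have "\<exists>K>0. \<forall>k\<ge>1. spectral_norm (P\<^sub>m - Pmk k) \<le> K * M.\<gamma> ^ k * spectral_norm (P - Pk 0)"
  proof (cases "Pk 0 = P")
    case True
    have "?d k = 0" for k
    proof (induction k)
      case (Suc k) then show ?case using closeN[of k] by (simp add: norm_minus_commute)
    qed (simp add: True)
    then have "Pmk (Suc k) = P\<^sub>m" for k using closeM[of k] by simp
    then have "Pmk k = P\<^sub>m" if "k \<ge> 1" for k using that by (metis Suc_le_D One_nat_def)
    then show ?thesis using True by (intro exI[of _ 1]) (simp add: spectral_norm_def onorm_zero)
  next
    case False
    then have d: "0 < spectral_norm (P - Pk 0)" by (intro spectral_norm_pos) simp
    \<comment> \<open>The sum takes care of the steps before the asymptotic regime sets in at \<open>k0\<close>.\<close>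
    define S where "S = (\<Sum>j<k0. norm (Pmk (Suc j) - P\<^sub>m) / M.\<gamma> ^ Suc j) + C * C1 / M.\<gamma>"
    have S: "0 < S" using M.gamma C C1 unfolding S_def by (intro add_nonneg_pos sum_nonneg divide_nonneg_nonneg) auto
    have bound: "norm (Pmk (Suc j) - P\<^sub>m) \<le> S * M.\<gamma> ^ Suc j" for j
    proof (cases "j < k0")
      case True
      then have "norm (Pmk (Suc j) - P\<^sub>m) / M.\<gamma> ^ Suc j \<le> (\<Sum>j<k0. norm (Pmk (Suc j) - P\<^sub>m) / M.\<gamma> ^ Suc j)"
        using M.gamma by (intro member_le_sum) auto
      also have "\<dots> \<le> S" using M.gamma C C1 by (simp add: S_def)
      finally show ?thesis using M.gamma by (simp add: field_simps)
    next
      case False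
      then have "norm (Pmk (Suc j) - P\<^sub>m) \<le> C * s j" by (intro s) simp
      also have "\<dots> \<le> C * (C1 * M.\<gamma> ^ j)" using C1 C False by (intro mult_left_mono) auto
      also have "\<dots> = C * C1 / M.\<gamma> * M.\<gamma> ^ Suc j" using M.gamma by simp
      also have "\<dots> \<le> S * M.\<gamma> ^ Suc j"
        using M.gamma unfolding S_def by (intro mult_right_mono) (auto intro!: sum_nonneg)
      finally show ?thesis .
    qed
    show ?thesis
    proof (intro exI[of _ "S / spectral_norm (P - Pk 0)"] conjI allI impI)
      show "0 < S / spectral_norm (P - Pk 0)" using S d by simp
      fix k :: nat assume "1 \<le> k"
      then obtain j where k: "k = Suc j" by (metis Suc_le_D One_nat_def)
      have "spectral_norm (P\<^sub>m - Pmk k) \<le> norm (Pmk k - P\<^sub>m)"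
        using spectral_norm_le[of "P\<^sub>m - Pmk k"] by (simp add: norm_minus_commute)
      also have "\<dots> \<le> S * M.\<gamma> ^ k" unfolding k by (rule bound)
      finally show "spectral_norm (P\<^sub>m - Pmk k) \<le> S / spectral_norm (P - Pk 0) * M.\<gamma> ^ k * spectral_norm (P - Pk 0)"
        using d by simp
    qed
  qed
  then show ?thesis using conv \<gamma> by (metis order_refl)
qed

end
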